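(* Let $\Omega\subset\mathbb R^2$ be a domain near infinity with solid boundary $B$ and angle $\Theta$, as defined in the context, with $\Theta\notin\{0,\pi,2\pi\}$. Then there does not exist an incompressible (irrotational) flow $\psi$ in $\Omega$ (as defined in the context) whose velocity $\mathbf v=-\nabla^\perp\psi$ is bounded but does not vanish at infinity. That is, if $\psi$ is an incompressible flow in $\Omega$ with $\sup_\Omega|\mathbf v|<\infty$, then $$\sup_{\mathbf x\in\Omega,\ |\mathbf x|>R}|\mathbf v(\mathbf x)|\to0\quad\text{as } R\to\infty .$$
   Context: **Domain.** Let $0<\underline r<\infty$ and let $\theta^0,\theta^1$ be $C^3$ functions of $r\in(\underline r,\infty)$ with $0<\theta^1(r)-\theta^0(r)<2\pi$ for all $r$. Suppose that for some constants $C<\infty$, $\epsilon>0$, $$\Big|\frac{d^k\theta^q}{dr^k}(r)\Big|\le C r^{-k-\epsilon}\qquad (q=0,1;\ k=1,2,3;\ r>\underline r).$$ Then the limits $\theta^q(\infty)=\lim_{r\to\infty}\theta^q(r)$ exist. In polar coordinates $(r,\theta)$ of $\mathbb R^2$ set $$\Omega=\{(r,\theta): r>\underline r,\ \theta^0(r)<\theta<\theta^1(r)\},\qquad B=\{(r,\theta): r>\underline r,\ \theta\in\{\theta^0(r),\theta^1(r)\}\}.$$ $B$ is called the solid boundary. The angle is $\Theta=\theta^1(\infty)-\theta^0(\infty)$, assumed to lie in $(0,\pi)$ or $(\pi,2\pi)$. **Incompressible flow.** This is a stream function $\psi$ that is harmonic in $\Omega$ ($\Delta\psi=0$) and satisfies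 the slip condition $\psi=0$ on $B$ (when the gradient is bounded, as in the claim, $\psi$ has a well-defined trace on $B$). Its velocity is $\mathbf v=-\nabla^\perp\psi$ with $\nabla^\perp=(-\partial_y,\partial_x)$. *)

theory Defs
  imports "HOL-Complex_Analysis.Complex_Analysis"
begin

text \<open>
  The plane is identified with the type \<^typ>\<open>complex\<close>, so that the point with polar
  coordinates (r, t) is \<^term>\<open>rcis r t\<close>.
\<close>

section \<open>Domains near infinity\<close>

text \<open>
  For open \<open>S\<close> only: derivatives are two-sided, so values of \<open>f\<close> outside \<open>S\<close> are irrelevant.
\<close>
definition Ck_on :: "nat \<Rightarrow> (real \<Rightarrow> real) \<Rightarrow> real set \<Rightarrow> bool" where
  "Ck_on k f S \<longleftrightarrow>
     (\<forall>i<k. \<forall>x\<in>S. ((deriv ^^ i) f) field_differentiable (at x)) \<and>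
     continuous_on S ((deriv ^^ k) f)"

definition near_infinity_data :: "real \<Rightarrow> (real \<Rightarrow> real) \<Rightarrow> (real \<Rightarrow> real) \<Rightarrow> bool" where
  "near_infinity_data r0 \<theta>0 \<theta>1 \<longleftrightarrow>
     0 < r0 \<and>
     Ck_on 3 \<theta>0 {r0<..} \<and> Ck_on 3 \<theta>1 {r0<..} \<and>
     (\<forall>r>r0. 0 < \<theta>1 r - \<theta>0 r \<and> \<theta>1 r - \<theta>0 r < 2 * pi) \<and>
     (\<exists>C \<epsilon>. 0 < \<epsilon> \<and>
        (\<forall>\<theta>\<in>{\<theta>0, \<theta>1}. \<forall>k\<in>{1..3}. \<forall>r>r0.
           \<bar>(deriv ^^ k) \<theta> r\<bar> \<le> C * r powr (- real k - \<epsilon>)))"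

definition flow_domain :: "real \<Rightarrow> (real \<Rightarrow> real) \<Rightarrow> (real \<Rightarrow> real) \<Rightarrow> complex set" where
  "flow_domain r0 \<theta>0 \<theta>1 = {rcis r t | r t. r0 < r \<and> \<theta>0 r < t \<and> t < \<theta>1 r}"

definition solid_boundary :: "real \<Rightarrow> (real \<Rightarrow> real) \<Rightarrow> (real \<Rightarrow> real) \<Rightarrow> complex set" where
  "solid_boundary r0 \<theta>0 \<theta>1 = {rcis r t | r t. r0 < r \<and> t \<in> {\<theta>0 r, \<theta>1 r}}"

text \<open>Both limits exist, see \<open>near_infinity_data_limits\<close> below.\<close>
definition domain_angle :: "(real \<Rightarrow> real) \<Rightarrow> (real \<Rightarrow> real) \<Rightarrow> real" where
  "domain_angle \<theta>0 \<theta>1 = Lim at_top \<theta>1 - Lim at_top \<theta>0"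

lemma tendsto_at_top_of_deriv_bound:
  fixes f :: "real \<Rightarrow> real"
  assumes r0: "0 < r0" and eps: "0 < \<epsilon>"
    and diff: "\<And>r. r0 < r \<Longrightarrow> f field_differentiable (at r)"
    and bound: "\<And>r. r0 < r \<Longrightarrow> \<bar>deriv f r\<bar> \<le> C * r powr (- 1 - \<epsilon>)"
  shows "(f \<longlongrightarrow> Lim at_top f) at_top"
proof -
  define g where "g r = - (C / \<epsilon>) * r powr (- \<epsilon>)" for r :: real
  have dg: "(g has_real_derivative C * r powr (- 1 - \<epsilon>)) (at r)" if "r0 < r" for r
    unfolding g_def using that r0 eps
    by (auto intro!: derivative_eq_intros simp: minus_diff_commute[of \<epsilon> 1])
  have df: "(f has_real_derivative deriv f r) (at r)" if "r0 < r" for r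
    using diff[OF that] by (simp add: field_differentiable_derivI)
  have gf: "\<bar>f y - f x\<bar> \<le> g y - g x" if "r0 < x" "x \<le> y" for x y
  proof -
    have 1: "g x - f x \<le> g y - f y"
    proof (rule DERIV_nonneg_imp_nondecreasing[OF that(2), where f = "\<lambda>r. g r - f r"])
      fix r assume "x \<le> r" "r \<le> y"
      then have r: "r0 < r" using that by simp
      show "\<exists>d. ((\<lambda>r. g r - f r) has_real_derivative d) (at r) \<and> 0 \<le> d"
        using DERIV_diff[OF dg[OF r] df[OF r]] bound[OF r] by fastforce
    qed
    have 2: "g x + f x \<le> g y + f y"
    proof (rule DERIV_nonneg_imp_nondecreasing[OF that(2), where f = "\<lambda>r. g r + f r"])
      fix r assume "x \<le> r" "r \<le> y"
      then have r: "r0 < r" using that by simp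
      show "\<exists>d. ((\<lambda>r. g r + f r) has_real_derivative d) (at r) \<and> 0 \<le> d"
        using DERIV_add[OF dg[OF r] df[OF r]] bound[OF r] by fastforce
    qed
    from 1 2 show ?thesis by linarith
  qed
  have g0: "(g \<longlongrightarrow> 0) at_top"
    unfolding g_def
    using tendsto_mult_right_zero[OF tendsto_neg_powr[OF _ filterlim_ident], of "- \<epsilon>" "- (C / \<epsilon>)"]
      eps by simp
  have gn: "(\<lambda>n. g (real n)) \<longlonglongrightarrow> 0"
    by (rule filterlim_compose[OF g0 filterlim_real_sequentially])
  have "Cauchy (\<lambda>n. f (real n))"
  proof (rule metric_CauchyI)
    fix e :: real assume "0 < e"
    obtain M where M: "\<And>m n. m \<ge> M \<Longrightarrow> n \<ge> M \<Longrightarrow> dist (g (real m)) (g (real n)) < e"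
      using LIMSEQ_imp_Cauchy[OF gn] \<open>0 < e\<close> by (meson metric_CauchyD)
    obtain N where N: "r0 < real N" using reals_Archimedean2 by blast
    show "\<exists>M. \<forall>m\<ge>M. \<forall>n\<ge>M. dist (f (real m)) (f (real n)) < e"
    proof (intro exI allI impI)
      fix m n assume mn: "max M N \<le> m" "max M N \<le> n"
      then have "r0 < real m" "r0 < real n" using N by (auto intro: less_le_trans)
      then show "dist (f (real m)) (f (real n)) < e"
        using gf[of "real m" "real n"] gf[of "real n" "real m"] M[of m n] mn
        by (cases "m \<le> n") (auto simp: dist_real_def)
    qed
  qed
  then obtain L where L: "(\<lambda>n. f (real n)) \<longlonglongrightarrow> L"
    using Cauchy_convergent convergent_def by blast
  have "\<bar>L - f x\<bar> \<le> 0 - g x" if "r0 < x" for x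
  proof (rule tendsto_le[OF sequentially_bot])
    show "(\<lambda>n. g (real n) - g x) \<longlonglongrightarrow> 0 - g x" by (intro tendsto_intros gn)
    show "(\<lambda>n. \<bar>f (real n) - f x\<bar>) \<longlonglongrightarrow> \<bar>L - f x\<bar>" by (intro tendsto_intros L)
    have "\<forall>\<^sub>F n in sequentially. x \<le> real n"
      using filterlim_real_sequentially by (simp add: filterlim_at_top)
    then show "\<forall>\<^sub>F n in sequentially. \<bar>f (real n) - f x\<bar> \<le> g (real n) - g x"
      by eventually_elim (use gf that in blast)
  qed
  then have "\<forall>\<^sub>F x in at_top. norm (f x - L) \<le> - g x"
    by (intro eventually_mono[OF eventually_gt_at_top[of r0]]) (simp add: abs_minus_commute)
  moreover have "((\<lambda>x. - g x) \<longlongrightarrow> 0) at_top" using tendsto_minus[OF g0] by simp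
  ultimately have "((\<lambda>x. f x - L) \<longlongrightarrow> 0) at_top" by (rule Lim_null_comparison)
  then have "(f \<longlongrightarrow> L) at_top" by (simp add: LIM_zero_iff)
  then show ?thesis using tendsto_Lim[OF trivial_limit_at_top_linorder] by metis
qed

lemma near_infinity_data_limits:
  assumes "near_infinity_data r0 \<theta>0 \<theta>1"
  shows "(\<theta>0 \<longlongrightarrow> Lim at_top \<theta>0) at_top" "(\<theta>1 \<longlongrightarrow> Lim at_top \<theta>1) at_top"
proof -
  obtain C \<epsilon> where r0: "0 < r0" and eps: "0 < \<epsilon>"
    and bd: "\<And>\<theta> k r. \<theta> \<in> {\<theta>0, \<theta>1} \<Longrightarrow> k \<in> {1..3} \<Longrightarrow> r0 < r \<Longrightarrow>
               \<bar>(deriv ^^ k) \<theta> r\<bar> \<le> C * r powr (- real k - \<epsilon>)"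
    and Ck: "Ck_on 3 \<theta>0 {r0<..}" "Ck_on 3 \<theta>1 {r0<..}"
    using assms unfolding near_infinity_data_def by blast
  have "(\<theta> \<longlongrightarrow> Lim at_top \<theta>) at_top" if th: "\<theta> \<in> {\<theta>0, \<theta>1}" for \<theta>
  proof (rule tendsto_at_top_of_deriv_bound[OF r0 eps])
    fix r assume r: "r0 < r"
    have "Ck_on 3 \<theta> {r0<..}" using Ck th by auto
    then have "((deriv ^^ 0) \<theta>) field_differentiable (at r)"
      using r unfolding Ck_on_def by (metis greaterThan_iff zero_less_numeral)
    then show "\<theta> field_differentiable (at r)" by simp
    show "\<bar>deriv \<theta> r\<bar> \<le> C * r powr (- 1 - \<epsilon>)" using bd[OF th, of 1 r] r by simp
  qed
  then show "(\<theta>0 \<longlongrightarrow> Lim at_top \<theta>0) at_top" "(\<theta>1 \<longlongrightarrow> Lim at_top \<theta>1) at_top"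
    by auto
qed


section \<open>Incompressible flows\<close>

definition partial_x :: "(complex \<Rightarrow> real) \<Rightarrow> complex \<Rightarrow> real" where
  "partial_x f z = frechet_derivative f (at z) 1"

definition partial_y :: "(complex \<Rightarrow> real) \<Rightarrow> complex \<Rightarrow> real" where
  "partial_y f z = frechet_derivative f (at z) \<i>"

text \<open>As for \<^const>\<open>Ck_on\<close>, the set is meant to be open.\<close>
definition C2_on :: "(complex \<Rightarrow> real) \<Rightarrow> complex set \<Rightarrow> bool" where
  "C2_on f S \<longleftrightarrow>
     (\<forall>z\<in>S. f differentiable (at z)) \<and>
     (\<forall>g\<in>{partial_x f, partial_y f}.
        (\<forall>z\<in>S. g differentiable (at z)) \<and>
        continuous_on S (partial_x g) \<and> continuous_on S (partial_y g))"

definition laplacian :: "(complex \<Rightarrow> real) \<Rightarrow> complex \<Rightarrow> real" where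
  "laplacian f z = partial_x (partial_x f) z + partial_y (partial_y f) z"

definition harmonic_on :: "(complex \<Rightarrow> real) \<Rightarrow> complex set \<Rightarrow> bool" where
  "harmonic_on f S \<longleftrightarrow> C2_on f S \<and> (\<forall>z\<in>S. laplacian f z = 0)"

definition perp_grad :: "(complex \<Rightarrow> real) \<Rightarrow> complex \<Rightarrow> complex" where
  "perp_grad f z = Complex (- partial_y f z) (partial_x f z)"

definition velocity :: "(complex \<Rightarrow> real) \<Rightarrow> complex \<Rightarrow> complex" where
  "velocity \<psi> z = - perp_grad \<psi> z"

text \<open>
  The slip condition is imposed on the trace of \<open>\<psi>\<close>, taken as the limit from inside the domain;
  the values that the total function \<open>\<psi>\<close> has on or beyond the boundary play no role.  For a flow
  with bounded velocity, \<open>\<psi>\<close> is Lipschitz near each boundary point, so the limit exists.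
\<close>
definition incompressible_flow ::
  "real \<Rightarrow> (real \<Rightarrow> real) \<Rightarrow> (real \<Rightarrow> real) \<Rightarrow> (complex \<Rightarrow> real) \<Rightarrow> bool" where
  "incompressible_flow r0 \<theta>0 \<theta>1 \<psi> \<longleftrightarrow>
     harmonic_on \<psi> (flow_domain r0 \<theta>0 \<theta>1) \<and>
     (\<forall>b\<in>solid_boundary r0 \<theta>0 \<theta>1. (\<psi> \<longlongrightarrow> 0) (at b within flow_domain r0 \<theta>0 \<theta>1))"

end

theory Submission
  imports Defs
begin

text \<open>
  In the logarithmic coordinate w = log z the domain becomes a curved half-strip that flattens out as
  Re w tends to infinity, and the stream function becomes a harmonic u with gradient O(exp (Re w)).
  First, u = o(exp (Re w)): otherwise translates of u, rescaled by exp (- Re w), converge along a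
  subsequence to a nonzero harmonic function on the exact strip of width \<Theta> that vanishes on the boundary
  and whose gradient is O(exp (Re w)) in both directions; mapping the strip to a half-plane by
  \<zeta> = exp (\<pi> w / \<Theta>) and reflecting gives a holomorphic function on the punctured plane that is
  O(|\<zeta>| powr (\<Theta> / \<pi>)), hence zero because \<Theta> / \<pi> is not an integer. Second, since the boundary
  curves have small curvature, a quadratic harmonic barrier improves this to
  u = o(exp (Re w)) times the distance to the boundary, and the interior gradient estimate then gives
  a velocity that tends to zero uniformly up to the boundary.
\<close>

section \<open>Harmonic functions with a holomorphic gradient\<close>

text \<open>The logarithm turns dilations about the origin into translations, so zooming out of the
  domain is shifting it to the left. Compensating each shift by the factor exp (- shift) keeps the
  bound \<open>M * exp (Re w)\<close> on the gradient, and the limit inherits it at both ends of the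
  exact strip. In the half-plane coordinate this is one and the same power at 0 and at infinity,
  which only a monomial of exactly that exponent can satisfy; for angle pi that monomial is the
  uniform flow along a half-plane.

  The obstacle is the boundary. Compactness yields convergence inside the strip only, and the
  interior gradient estimate divides by the distance to the boundary. Bounds on u that are linear in
  this distance answer both difficulties. With the constant M such a bound follows by integrating
  the gradient from the boundary; it keeps the points where u is large away from the edges before
  the limit is taken. With a small constant it comes from the barrier, and it cancels the division
  in the gradient estimate. Reflection is reserved for the limit, whose boundary lines are
  straight.\<close>

text \<open>
  The complex gradient g stands for \<open>v\<^sub>x - \<i> v\<^sub>y\<close>, so that v is locally the real part of a primitive of g.
\<close>
definition cgrad_on :: "(complex \<Rightarrow> real) \<Rightarrow> (complex \<Rightarrow> complex) \<Rightarrow> complex set \<Rightarrow> bool" where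
  "cgrad_on v g E \<longleftrightarrow>
     g holomorphic_on E \<and> (\<forall>w\<in>E. (v has_derivative (\<lambda>h. Re (g w * h))) (at w))"

lemma cgrad_on_subset: "cgrad_on v g E \<Longrightarrow> E' \<subseteq> E \<Longrightarrow> cgrad_on v g E'"
  unfolding cgrad_on_def by (meson holomorphic_on_subset subsetD)

lemma cgrad_on_continuous: "cgrad_on v g E \<Longrightarrow> continuous_on E v"
  unfolding cgrad_on_def
  by (meson continuous_at_imp_continuous_on has_derivative_continuous)

lemma cgrad_on_diff:
  assumes "cgrad_on u f E" "cgrad_on v g E"
  shows "cgrad_on (\<lambda>w. u w - v w) (\<lambda>w. f w - g w) E"
  using assms unfolding cgrad_on_def
  by (auto intro!: holomorphic_intros derivative_eq_intros simp: algebra_simps)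

lemma cgrad_on_Re:
  assumes "open E" "F holomorphic_on E"
  shows "cgrad_on (\<lambda>w. Re (F w)) (deriv F) E"
proof -
  have "((\<lambda>w. Re (F w)) has_derivative (\<lambda>h. Re (deriv F w * h))) (at w)" if "w \<in> E" for w
  proof -
    have "(F has_field_derivative deriv F w) (at w)"
      using holomorphic_derivI[OF assms(2,1) that] .
    then show ?thesis
      unfolding has_field_derivative_def by (auto intro!: derivative_eq_intros)
  qed
  then show ?thesis
    unfolding cgrad_on_def using holomorphic_deriv[OF assms(2,1)] by auto
qed

text \<open>The bridge from harmonic to holomorphic functions: \<open>g\<close> has a primitive on a
  convex set, and a real additive constant, fixed at one point, makes its real part agree with
  \<open>v\<close>.\<close>

lemma cgrad_on_primitive:
  assumes "convex E" "open E" "cgrad_on v g E"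
  obtains F where "\<And>w. w \<in> E \<Longrightarrow> (F has_field_derivative g w) (at w)"
    "\<And>w. w \<in> E \<Longrightarrow> Re (F w) = v w"
proof (cases "E = {}")
  case True
  then show ?thesis using that by blast
next
  case False
  then obtain p where p: "p \<in> E" by blast
  obtain F0 where F0: "\<And>w. w \<in> E \<Longrightarrow> (F0 has_field_derivative g w) (at w)"
    using holomorphic_convex_primitive'[of E g] assms unfolding cgrad_on_def
    by (metis at_within_open)
  define F where "F w = F0 w + of_real (v p - Re (F0 p))" for w
  have F: "(F has_field_derivative g w) (at w)" if "w \<in> E" for w
    unfolding F_def using F0[OF that] by (auto intro!: derivative_eq_intros)
  have "Re (F w) - v w = Re (F p) - v p" if w: "w \<in> E" for w
  proof (rule has_derivative_zero_unique[OF assms(1) _ p w, symmetric])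
    fix x assume x: "x \<in> E"
    show "((\<lambda>x. Re (F x) - v x) has_derivative (\<lambda>h. 0)) (at x within E)"
      using F[OF x] assms(3) x unfolding cgrad_on_def has_field_derivative_def
      by (auto intro!: derivative_eq_intros intro: has_derivative_at_withinI)
  qed
  then show ?thesis using that[of F] F by (simp add: F_def)
qed

text \<open>If \<open>v\<close> is the real part of \<open>F\<close>, then \<open>exp (F w)\<close>
  has modulus \<open>exp (v w)\<close>, so the maximum modulus principle applies to it.\<close>

lemma cgrad_on_local_max:
  assumes "0 < e" "cgrad_on v g (ball x e)" "\<And>w. w \<in> ball x e \<Longrightarrow> v w \<le> v x" "w \<in> ball x e"
  shows "v w = v x"
proof -
  obtain F where F: "\<And>w. w \<in> ball x e \<Longrightarrow> (F has_field_derivative g w) (at w)"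
    "\<And>w. w \<in> ball x e \<Longrightarrow> Re (F w) = v w"
    using cgrad_on_primitive[OF convex_ball open_ball assms(2)] by blast
  have hol: "F holomorphic_on ball x e"
    using F(1) by (meson field_differentiable_at_within field_differentiable_def holomorphic_onI)
  have "(\<lambda>w. exp (F w)) constant_on ball x e"
    by (rule maximum_modulus_principle[where U = "ball x e" and \<xi> = x])
       (use assms F hol in \<open>auto intro!: holomorphic_intros\<close>)
  then have "exp (F w) = exp (F x)"
    using assms(1,4) unfolding constant_on_def by (metis centre_in_ball)
  then have "norm (exp (F w)) = norm (exp (F x))" by simp
  then show ?thesis using F(2) assms(1,4) by simp
qed

text \<open>The boundary condition says limsup at most 0, in a form that does not require boundary
  values: the flow has only traces, and part of the frontier will lie inside the flow domain. It
  makes every superlevel set at a positive level compact. If \<open>v\<close> were positive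
  somewhere, the set of its maximum points would be compact, nonempty and, by
  \<open>cgrad_on_local_max\<close>, open, but the plane has no bounded nonempty clopen
  subset.\<close>

lemma cgrad_on_maximum_principle:
  assumes E: "open E" "bounded E" and v: "cgrad_on v g E"
    and bdry: "\<And>b \<eta>. b \<in> frontier E \<Longrightarrow> 0 < \<eta> \<Longrightarrow> \<forall>\<^sub>F w in at b within E. v w < \<eta>"
    and w: "w \<in> E"
  shows "v w \<le> 0"
proof (rule ccontr)
  assume "\<not> v w \<le> 0"
  then have pos: "0 < v w" by simp
  have comp: "compact {x \<in> E. c \<le> v x}" if c: "0 < c" for c
  proof -
    have "closed {x \<in> E. c \<le> v x}"
      unfolding closed_sequential_limits
    proof (intro allI impI, elim conjE)
      fix s l assume s: "\<forall>n. s n \<in> {x \<in> E. c \<le> v x}" and l: "s \<longlonglongrightarrow> l"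
      have lE: "l \<in> E"
      proof (rule ccontr)
        assume nE: "l \<notin> E"
        have "l \<in> closure E" using s l by (auto simp: closure_sequential)
        then have "l \<in> frontier E" using nE E(1) by (simp add: frontier_def interior_open)
        then have ev: "\<forall>\<^sub>F w in at l within E. v w < c" using bdry c by blast
        have "filterlim s (at l within E) sequentially"
          unfolding filterlim_at using l s nE by (auto intro!: always_eventually)
        then have "\<forall>\<^sub>F n in sequentially. v (s n) < c"
          by (rule eventually_compose_filterlim[OF ev])
        then obtain n where "v (s n) < c" using eventually_happens'[OF sequentially_bot] by blast
        then show False using s by (metis (mono_tags, lifting) mem_Collect_eq not_less)
      qed
      have "isCont v l" using cgrad_on_continuous[OF v] E(1) lE
        by (simp add: continuous_on_eq_continuous_at)
      then have "(\<lambda>n. v (s n)) \<longlonglongrightarrow> v l" using l isCont_tendsto_compose by blast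
      then have "c \<le> v l" using s by (intro LIMSEQ_le_const) auto
      then show "l \<in> {x \<in> E. c \<le> v x}" using lE by simp
    qed
    moreover have "bounded {x \<in> E. c \<le> v x}" using E(2) by (rule bounded_subset) auto
    ultimately show ?thesis by (simp add: compact_eq_bounded_closed)
  qed
  obtain \<xi> where \<xi>: "\<xi> \<in> E" "v w \<le> v \<xi>" "\<And>x. x \<in> E \<Longrightarrow> v w \<le> v x \<Longrightarrow> v x \<le> v \<xi>"
  proof -
    let ?K = "{x \<in> E. v w \<le> v x}"
    have c: "continuous_on ?K v" using cgrad_on_continuous[OF v] by (rule continuous_on_subset) auto
    have ne: "?K \<noteq> {}" using w by auto
    from continuous_attains_sup[OF comp[OF pos] ne c]
    obtain x where x: "x \<in> ?K" "\<forall>y\<in>?K. v y \<le> v x" by (elim bexE)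
    show ?thesis by (rule that[of x]) (use x in auto)
  qed
  have max: "v x \<le> v \<xi>" if "x \<in> E" for x using \<xi>(2) \<xi>(3)[OF that] by linarith
  let ?M = "{x \<in> E. v \<xi> \<le> v x}"
  have "compact ?M" using comp pos \<xi>(2) by simp
  moreover have "open ?M"
    unfolding open_contains_ball
  proof
    fix x assume x: "x \<in> ?M"
    then obtain e where e: "0 < e" "ball x e \<subseteq> E" using E(1) open_contains_ball by blast
    have "v y = v x" if "y \<in> ball x e" for y
    proof (rule cgrad_on_local_max[OF e(1) cgrad_on_subset[OF v e(2)] _ that])
      fix z assume "z \<in> ball x e"
      then show "v z \<le> v x" using max[of z] x e(2) by auto
    qed
    then have "ball x e \<subseteq> ?M" using x e(2) by auto
    then show "\<exists>e>0. ball x e \<subseteq> ?M" using e(1) by blast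
  qed
  ultimately have "?M = {} \<or> ?M = UNIV" "bounded ?M"
    using clopen[of ?M] compact_imp_closed compact_imp_bounded by auto
  then show False using \<xi>(1) not_bounded_UNIV by auto
qed

text \<open>The factor 2 comes from applying Cauchy's inequality on the ball of half the radius. One
  factor \<open>exp 1\<close> is the upper bound for the modulus of \<open>h\<close> there, the
  other is paid for dividing by the modulus of \<open>h x\<close>, which is at least
  \<open>exp (-1)\<close>.\<close>

lemma cgrad_on_gradient_bound:
  assumes d: "0 < d" and m: "0 < m" and v: "cgrad_on v g (ball x d)"
    and bd: "\<And>w. w \<in> ball x d \<Longrightarrow> \<bar>v w\<bar> \<le> m"
  shows "norm (g x) \<le> 2 * exp 2 * m / d"
proof -
  obtain F where F: "\<And>w. w \<in> ball x d \<Longrightarrow> (F has_field_derivative g w) (at w)"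
    "\<And>w. w \<in> ball x d \<Longrightarrow> Re (F w) = v w"
    using cgrad_on_primitive[OF convex_ball open_ball v] by blast
  \<comment> \<open>The exponential turns the one-sided bound on Re F into a bound on a modulus, at the scale m
    that is optimal for Cauchy's inequality.\<close>
  define h where "h w = exp (F w / of_real m)" for w
  have dh: "(h has_field_derivative g w / of_real m * h w) (at w)" if "w \<in> ball x d" for w
    unfolding h_def using F(1)[OF that] m by (auto intro!: derivative_eq_intros)
  have hol: "h holomorphic_on ball x d"
    using dh by (meson field_differentiable_at_within field_differentiable_def holomorphic_onI)
  have nh: "norm (h w) = exp (v w / m)" if "w \<in> ball x d" for w
    using F(2)[OF that] by (simp add: h_def Re_divide_of_real)
  have sub: "cball x (d/2) \<subseteq> ball x d" using d by auto
  have "norm ((deriv ^^ 1) h x) \<le> fact 1 * exp 1 / (d/2) ^ 1"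
  proof (rule Cauchy_inequality)
    show "h holomorphic_on ball x (d/2)" using hol holomorphic_on_subset sub
      by (meson ball_subset_cball subset_trans)
    show "continuous_on (cball x (d/2)) h"
      using hol holomorphic_on_imp_continuous_on continuous_on_subset sub by blast
    fix y assume "norm (x - y) = d/2"
    then have y: "y \<in> ball x d" using d by (simp add: dist_norm)
    have "v y / m \<le> 1" using bd[OF y] m by simp
    then show "norm (h y) \<le> exp 1" using nh[OF y] by simp
  qed (use d in auto)
  moreover have xb: "x \<in> ball x d" using d by simp
  moreover have "deriv h x = g x / of_real m * h x" using dh[OF xb] by (rule DERIV_imp_deriv)
  ultimately have 1: "norm (g x) / m * exp (v x / m) \<le> 2 * exp 1 / d"
    using nh[OF xb] m by (simp add: norm_mult norm_divide mult.commute)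
  have "exp (-1) \<le> exp (v x / m)" using bd[OF xb] m by (simp add: field_simps)
  then have "norm (g x) / m * exp (-1) \<le> norm (g x) / m * exp (v x / m)"
    using m by (intro mult_left_mono) auto
  with 1 have "norm (g x) / m * exp (-1) \<le> 2 * exp 1 / d" by linarith
  then have "norm (g x) / m * exp (-1) * exp 1 \<le> 2 * exp 1 / d * exp 1"
    by (intro mult_right_mono) auto
  moreover have "norm (g x) / m * exp (-1) * exp 1 = norm (g x) / m" by (simp add: exp_minus)
  moreover have "2 * exp 1 / d * exp 1 = 2 * exp 2 / d" by (simp flip: exp_add)
  ultimately have "norm (g x) / m \<le> 2 * exp 2 / d" by linarith
  then show ?thesis using m by (simp add: field_simps)
qed

section \<open>Harmonic functions in terms of partial derivatives\<close>

text \<open>Two applications of the mean value theorem: in direction \<open>a\<close> to the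
  difference of \<open>f\<close> along two opposite edges of the parallelogram, then in direction
  \<open>b\<close> to the directional derivative so obtained.\<close>

lemma second_difference_mvt:
  fixes f :: "'a::real_normed_vector \<Rightarrow> real" and a b z :: 'a
  defines "p \<equiv> \<lambda>x y. z + (x *\<^sub>R a + y *\<^sub>R b)"
  assumes h: "0 < h"
    and df: "\<And>x y. 0 \<le> x \<Longrightarrow> x \<le> h \<Longrightarrow> 0 \<le> y \<Longrightarrow> y \<le> h \<Longrightarrow> f differentiable (at (p x y))"
    and ddf: "\<And>x y. 0 \<le> x \<Longrightarrow> x \<le> h \<Longrightarrow> 0 \<le> y \<Longrightarrow> y \<le> h \<Longrightarrow>
      (\<lambda>w. frechet_derivative f (at w) a) differentiable (at (p x y))"
  obtains x y where "0 < x" "x < h" "0 < y" "y < h"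
    "f (p h h) - f (p h 0) - f (p 0 h) + f (p 0 0) =
       h * h * frechet_derivative (\<lambda>w. frechet_derivative f (at w) a) (at (p x y)) b"
proof -
  have line: "((\<lambda>t. F (p t y)) has_real_derivative frechet_derivative F (at (p t y)) a) (at t)"
    if "F differentiable (at (p t y))" for F :: "'a \<Rightarrow> real" and t y
  proof -
    have "(F has_derivative frechet_derivative F (at (p t y))) (at (p t y))"
      using that frechet_derivative_works by blast
    then have "((\<lambda>t. F (p t y)) has_derivative (\<lambda>s. frechet_derivative F (at (p t y)) (s *\<^sub>R a))) (at t)"
      unfolding p_def by (rule has_derivative_compose[rotated]) (auto intro!: derivative_eq_intros)
    moreover have "frechet_derivative F (at (p t y)) (s *\<^sub>R a) = s * frechet_derivative F (at (p t y)) a" for s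
      using linear_frechet_derivative[OF that] by (simp add: linear_scale)
    ultimately show ?thesis by (simp add: has_field_derivative_def mult.commute[of _ "frechet_derivative F (at (p t y)) a"])
  qed
  have line': "((\<lambda>t. F (p x t)) has_real_derivative frechet_derivative F (at (p x t)) b) (at t)"
    if "F differentiable (at (p x t))" for F :: "'a \<Rightarrow> real" and t x
  proof -
    have "(F has_derivative frechet_derivative F (at (p x t))) (at (p x t))"
      using that frechet_derivative_works by blast
    then have "((\<lambda>t. F (p x t)) has_derivative (\<lambda>s. frechet_derivative F (at (p x t)) (s *\<^sub>R b))) (at t)"
      unfolding p_def by (rule has_derivative_compose[rotated]) (auto intro!: derivative_eq_intros)
    moreover have "frechet_derivative F (at (p x t)) (s *\<^sub>R b) = s * frechet_derivative F (at (p x t)) b" for s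
      using linear_frechet_derivative[OF that] by (simp add: linear_scale)
    ultimately show ?thesis by (simp add: has_field_derivative_def mult.commute[of _ "frechet_derivative F (at (p x t)) b"])
  qed
  let ?g = "\<lambda>w. frechet_derivative f (at w) a"
  have "\<exists>x>0. x < h \<and> (f (p h h) - f (p h 0)) - (f (p 0 h) - f (p 0 0)) =
      (h - 0) * (?g (p x h) - ?g (p x 0))"
    by (rule MVT2[OF h]) (use h df in \<open>auto intro!: DERIV_diff line\<close>)
  then obtain x where x: "0 < x" "x < h"
    "(f (p h h) - f (p h 0)) - (f (p 0 h) - f (p 0 0)) = h * (?g (p x h) - ?g (p x 0))" by auto
  have "\<exists>y>0. y < h \<and> ?g (p x h) - ?g (p x 0) = (h - 0) * frechet_derivative ?g (at (p x y)) b"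
    by (rule MVT2[OF h]) (use h x ddf in \<open>auto intro!: line'\<close>)
  then obtain y where "0 < y" "y < h"
    "?g (p x h) - ?g (p x 0) = h * frechet_derivative ?g (at (p x y)) b" by auto
  then show thesis using that[OF x(1,2)] x(3) by simp
qed

text \<open>The second difference of \<open>f\<close> over a parallelogram is symmetric in
  \<open>a\<close> and \<open>b\<close>. By \<open>second_difference_mvt\<close> it is
  \<open>h * h\<close> times either mixed derivative at some nearby point, and continuity moves both
  points to \<open>z\<close>.\<close>

lemma mixed_derivatives_commute:
  fixes f :: "'a::real_normed_vector \<Rightarrow> real" and a b z :: 'a
  assumes S: "open S" "z \<in> S"
    and df: "\<And>w. w \<in> S \<Longrightarrow> f differentiable (at w)"
    and da: "\<And>w. w \<in> S \<Longrightarrow> (\<lambda>w. frechet_derivative f (at w) a) differentiable (at w)"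
    and db: "\<And>w. w \<in> S \<Longrightarrow> (\<lambda>w. frechet_derivative f (at w) b) differentiable (at w)"
    and ca: "continuous_on S (\<lambda>w. frechet_derivative (\<lambda>w. frechet_derivative f (at w) a) (at w) b)"
    and cb: "continuous_on S (\<lambda>w. frechet_derivative (\<lambda>w. frechet_derivative f (at w) b) (at w) a)"
  shows "frechet_derivative (\<lambda>w. frechet_derivative f (at w) a) (at z) b =
    frechet_derivative (\<lambda>w. frechet_derivative f (at w) b) (at z) a"
    (is "?A z = ?B z")
proof -
  have "\<bar>?A z - ?B z\<bar> \<le> e" if e: "0 < e" for e
  proof -
    have "isCont ?A z" "isCont ?B z"
      using ca cb S by (auto simp: continuous_on_eq_continuous_at)
    then have "(?A \<longlongrightarrow> ?A z) (nhds z)" "(?B \<longlongrightarrow> ?B z) (nhds z)"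
      unfolding continuous_at using tendsto_at_iff_tendsto_nhds[of ?A z] tendsto_at_iff_tendsto_nhds[of ?B z]
      by blast+
    then have "\<forall>\<^sub>F w in nhds z. dist (?A w) (?A z) < e/2 \<and> dist (?B w) (?B z) < e/2 \<and> w \<in> S"
      using e S by (intro eventually_conj tendstoD eventually_nhds_in_open) auto
    then obtain d where d: "0 < d"
      "\<And>w. dist w z < d \<Longrightarrow> dist (?A w) (?A z) < e/2 \<and> dist (?B w) (?B z) < e/2 \<and> w \<in> S"
      unfolding eventually_nhds_metric by blast
    \<comment> \<open>Small enough for the whole parallelogram to stay within distance d/2 of
      \<open>z\<close>; the summand 1 keeps the denominator positive when both directions are
      zero.\<close>
    define h where "h = d / (2 * (norm a + norm b + 1))"
    have pos: "0 < norm a + norm b + 1" by (simp add: add_nonneg_pos)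
    have h: "0 < h" using d(1) pos by (simp add: h_def)
    have near: "dist (z + (x *\<^sub>R a + y *\<^sub>R b)) z < d" if "0 \<le> x" "x \<le> h" "0 \<le> y" "y \<le> h" for x y
    proof -
      have "norm (x *\<^sub>R a + y *\<^sub>R b) \<le> x * norm a + y * norm b"
        using norm_triangle_ineq[of "x *\<^sub>R a" "y *\<^sub>R b"] that by simp
      also have "\<dots> \<le> h * norm a + h * norm b"
        using that by (intro add_mono mult_right_mono) auto
      also have "\<dots> \<le> h * (norm a + norm b + 1)" using h by (simp add: algebra_simps)
      also have "\<dots> = d / 2" using pos by (simp add: h_def field_simps del: distrib_left_numeral)
      also have "\<dots> < d" using d(1) by simp
      finally show ?thesis by (simp add: dist_norm)
    qed
    have near': "dist (z + (x *\<^sub>R b + y *\<^sub>R a)) z < d" if "0 \<le> x" "x \<le> h" "0 \<le> y" "y \<le> h" for x y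
      using near[of y x] that by (simp add: add.commute)
    obtain x y where xy: "0 < x" "x < h" "0 < y" "y < h"
      "f (z + (h *\<^sub>R a + h *\<^sub>R b)) - f (z + (h *\<^sub>R a + 0 *\<^sub>R b)) - f (z + (0 *\<^sub>R a + h *\<^sub>R b)) +
        f (z + (0 *\<^sub>R a + 0 *\<^sub>R b)) = h * h * ?A (z + (x *\<^sub>R a + y *\<^sub>R b))"
      by (rule second_difference_mvt[where f = f and z = z and a = a and b = b and h = h, OF h])
         (use df da d(2) near in blast)+
    obtain x' y' where xy': "0 < x'" "x' < h" "0 < y'" "y' < h"
      "f (z + (h *\<^sub>R b + h *\<^sub>R a)) - f (z + (h *\<^sub>R b + 0 *\<^sub>R a)) - f (z + (0 *\<^sub>R b + h *\<^sub>R a)) +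
        f (z + (0 *\<^sub>R b + 0 *\<^sub>R a)) = h * h * ?B (z + (x' *\<^sub>R b + y' *\<^sub>R a))"
      by (rule second_difference_mvt[where f = f and z = z and a = b and b = a and h = h, OF h])
         (use df db d(2) near' in blast)+
    have "h * h * ?A (z + (x *\<^sub>R a + y *\<^sub>R b)) = h * h * ?B (z + (x' *\<^sub>R b + y' *\<^sub>R a))"
      using xy(5) xy'(5) by (simp only: add.commute[of "_ *\<^sub>R b" "_ *\<^sub>R a"])
    then have "?A (z + (x *\<^sub>R a + y *\<^sub>R b)) = ?B (z + (x' *\<^sub>R b + y' *\<^sub>R a))"
      using h by simp
    moreover have "dist (?A (z + (x *\<^sub>R a + y *\<^sub>R b))) (?A z) < e/2"
      using d(2) near xy by simp
    moreover have "dist (?B (z + (x' *\<^sub>R b + y' *\<^sub>R a))) (?B z) < e/2"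
      using d(2) near' xy' by simp
    ultimately show ?thesis unfolding dist_real_def by linarith
  qed
  then show ?thesis using dense_ge[of 0 "\<bar>?A z - ?B z\<bar>"] by auto
qed

text \<open>This is the complex gradient \<psi>_x - i \<psi>_y, the derivative of any holomorphic
  function with real part \<psi>. The velocity is - i times its conjugate.\<close>

definition stream_gradient :: "(complex \<Rightarrow> real) \<Rightarrow> complex \<Rightarrow> complex" where
  "stream_gradient f z = Complex (partial_x f z) (- partial_y f z)"

lemma frechet_derivative_partials:
  assumes "f differentiable (at z)"
  shows "(f has_derivative (\<lambda>h. Re h * partial_x f z + Im h * partial_y f z)) (at z)"
proof -
  let ?D = "frechet_derivative f (at z)"
  have "?D h = Re h * partial_x f z + Im h * partial_y f z" for h
  proof -
    have "?D (Re h *\<^sub>R 1 + Im h *\<^sub>R \<i>) = Re h *\<^sub>R ?D 1 + Im h *\<^sub>R ?D \<i>"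
      using linear_frechet_derivative[OF assms] by (simp add: linear_add linear_scale del: scaleR_conv_of_real)
    moreover have "Re h *\<^sub>R 1 + Im h *\<^sub>R \<i> = h" by (simp add: complex_eq_iff)
    ultimately show ?thesis by (simp add: partial_x_def partial_y_def)
  qed
  then have "?D = (\<lambda>h. Re h * partial_x f z + Im h * partial_y f z)" by blast
  then show ?thesis using assms frechet_derivative_works by metis
qed

text \<open>Of the two Cauchy-Riemann equations for the complex gradient, one is Laplace's equation
  and the other is the symmetry of the mixed derivatives.\<close>

lemma harmonic_on_cgrad_on:
  assumes S: "open S" and f: "harmonic_on f S"
  shows "cgrad_on f (stream_gradient f) S"
proof -
  have C2: "C2_on f S" and lap: "\<And>z. z \<in> S \<Longrightarrow> laplacian f z = 0"
    using f by (auto simp: harmonic_on_def)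
  have df: "f differentiable (at z)" and dx: "partial_x f differentiable (at z)"
    and dy: "partial_y f differentiable (at z)" if "z \<in> S" for z
    using C2 that unfolding C2_on_def by auto
  have sym: "partial_y (partial_x f) z = partial_x (partial_y f) z" if z: "z \<in> S" for z
  proof -
    have c: "continuous_on S (partial_y (partial_x f))" "continuous_on S (partial_x (partial_y f))"
      using C2 unfolding C2_on_def by auto
    show ?thesis
      using mixed_derivatives_commute[OF S z, of f 1 \<i>] df dx dy c
      unfolding partial_x_def partial_y_def by blast
  qed
  have "(stream_gradient f has_field_derivative
      Complex (partial_x (partial_x f) z) (- partial_y (partial_x f) z)) (at z)" if z: "z \<in> S" for z
  proof -
    have yy: "partial_y (partial_y f) z = - partial_x (partial_x f) z"
      using lap[OF z] by (simp add: laplacian_def)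
    have "(stream_gradient f has_derivative (\<lambda>h.
        of_real (Re h * partial_x (partial_x f) z + Im h * partial_y (partial_x f) z) -
        \<i> * of_real (Re h * partial_x (partial_y f) z + Im h * partial_y (partial_y f) z))) (at z)"
    proof -
      have "stream_gradient f = (\<lambda>z. of_real (partial_x f z) - \<i> * of_real (partial_y f z))"
        by (auto simp: stream_gradient_def complex_eq_iff)
      then show ?thesis
        by (simp only:) (intro has_derivative_diff has_derivative_mult_right has_derivative_of_real
            frechet_derivative_partials dx dy z)
    qed
    moreover have "(\<lambda>h. of_real (Re h * partial_x (partial_x f) z + Im h * partial_y (partial_x f) z) -
        \<i> * of_real (Re h * partial_x (partial_y f) z + Im h * partial_y (partial_y f) z)) =
      (*) (Complex (partial_x (partial_x f) z) (- partial_y (partial_x f) z))"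
      by (auto simp: complex_eq_iff yy sym[OF z] algebra_simps)
    ultimately show ?thesis unfolding has_field_derivative_def by simp
  qed
  then have "stream_gradient f holomorphic_on S"
    by (meson field_differentiable_at_within field_differentiable_def holomorphic_onI)
  moreover have "(f has_derivative (\<lambda>h. Re (stream_gradient f z * h))) (at z)" if "z \<in> S" for z
    using frechet_derivative_partials[OF df[OF that]]
    by (simp add: stream_gradient_def mult.commute)
  ultimately show ?thesis unfolding cgrad_on_def by blast
qed

lemma norm_velocity: "norm (velocity \<psi> z) = norm (stream_gradient \<psi> z)"
  by (simp add: velocity_def perp_grad_def stream_gradient_def cmod_def add.commute)

section \<open>Rigidity in an exact strip\<close>

text \<open>Existence of a limit at each added point is enough because the target is regular. This
  serves functions on an unbounded strip that are uniformly continuous only on parts of it.\<close>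

lemma continuous_extension_pointwise:
  fixes f :: "'a::topological_space \<Rightarrow> 'b::metric_space"
  assumes "S \<subseteq> T" "T \<subseteq> closure S" "continuous_on S f"
    and lim: "\<And>t. t \<in> T - S \<Longrightarrow> \<exists>l. (f \<longlongrightarrow> l) (at t within S)"
  obtains g where "continuous_on T g" "\<And>x. x \<in> S \<Longrightarrow> g x = f x"
proof (rule continuous_map_extension_pointwise_alt[of euclidean S T euclidean f])
  show "\<exists>l. limitin euclidean f l (atin_within euclidean t S)" if "t \<in> T - S" for t
  proof -
    have "atin_within euclidean t S = at t within S"
      by (auto simp: filter_eq_iff eventually_atin_within eventually_at_topological)
    then show ?thesis using lim[OF that] by simp
  qed
  fix g assume "continuous_map (top_of_set T) euclidean g" "\<And>x. x \<in> S \<Longrightarrow> g x = f x"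
  then show thesis by (intro that[of g]) auto
qed (use assms(1-3) in \<open>simp_all add: regular_space_euclidean\<close>)

text \<open>Near 0 the function is bounded, so the singularity is removable. Cauchy's inequality on
  the circle of radius R bounds the n-th derivative at 0 by a multiple of
  \<open>R powr (\<alpha> - real n)\<close>. For n above \<open>\<alpha>\<close> let R tend to
  infinity, for n below let R tend to 0; the monomial with n equal to \<open>\<alpha>\<close> is the
  exception that the hypothesis rules out.\<close>

lemma punctured_plane_eq_0_of_powr_growth:
  assumes f: "f holomorphic_on (- {0})"
    and bd: "\<And>z. z \<noteq> 0 \<Longrightarrow> norm (f z) \<le> C * norm z powr \<alpha>"
    and \<alpha>: "0 < \<alpha>" "\<And>n::nat. \<alpha> \<noteq> real n" and z: "z \<noteq> 0"
  shows "f z = 0"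
proof -
  have C: "0 \<le> C" using bd[of 1] order_trans[OF norm_ge_zero[of "f 1"]] by simp
  have b1: "norm (f z) \<le> C" if "z \<noteq> 0" "norm z < 1" for z
  proof -
    have "norm z powr \<alpha> \<le> 1" using that \<alpha>(1) by (intro powr_le1) auto
    then have "C * norm z powr \<alpha> \<le> C * 1" using C by (rule mult_left_mono)
    then show ?thesis using bd[OF that(1)] by linarith
  qed
  have "\<forall>\<^sub>F z in at 0. norm (f z) \<le> C"
    unfolding eventually_at using b1 by (intro exI[of _ 1]) (auto simp: dist_norm)
  then have "\<exists>g. g holomorphic_on UNIV \<and> (\<forall>z\<in>UNIV - {0}. g z = f z)"
    using holomorphic_on_extend_bounded[of f UNIV 0] f by (auto simp: Compl_eq_Diff_UNIV)
  then obtain g where g: "g holomorphic_on UNIV" "\<And>z. z \<noteq> 0 \<Longrightarrow> g z = f z" by auto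
  have est: "norm ((deriv ^^ n) g 0) \<le> fact n * C * R powr (\<alpha> - real n)" if R: "0 < R" for n R
  proof -
    have "norm ((deriv ^^ n) g 0) \<le> fact n * (C * R powr \<alpha>) / R ^ n"
    proof (rule Cauchy_inequality[OF _ _ R])
      show "g holomorphic_on ball 0 R" "continuous_on (cball 0 R) g"
        using g(1) holomorphic_on_subset holomorphic_on_imp_continuous_on by blast+
      fix x :: complex assume "norm (0 - x) = R"
      then have "norm x = R" "x \<noteq> 0" using R by auto
      then show "norm (g x) \<le> C * R powr \<alpha>" using bd g(2) by metis
    qed
    then show ?thesis using R by (simp add: powr_diff powr_realpow)
  qed
  \<comment> \<open>Stated for an arbitrary filter so as to serve for both \<open>at_top\<close> and
    \<open>at_right 0\<close>.\<close>
  have lim0: "norm ((deriv ^^ n) g 0) \<le> 0"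
    if F: "((\<lambda>R. R powr (\<alpha> - real n)) \<longlongrightarrow> 0) F" "eventually (\<lambda>R. 0 < R) F" "F \<noteq> bot" for n F
  proof (rule tendsto_lowerbound)
    show "((\<lambda>R. fact n * C * R powr (\<alpha> - real n)) \<longlongrightarrow> 0) F"
      using tendsto_mult_right_zero[OF F(1)] .
    show "\<forall>\<^sub>F R in F. norm ((deriv ^^ n) g 0) \<le> fact n * C * R powr (\<alpha> - real n)"
      using F(2) by eventually_elim (rule est)
  qed (rule F(3))
  have "(deriv ^^ n) g 0 = 0" for n
  proof (cases "\<alpha> < real n")
    case True
    then show ?thesis
      using lim0[of n at_top] tendsto_neg_powr[OF _ filterlim_ident, of "\<alpha> - real n"]
      by (simp add: eventually_gt_at_top)
  next
    case False
    then have pos: "0 < \<alpha> - real n" using \<alpha>(2)[of n] by simp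
    have "((\<lambda>R. R powr (\<alpha> - real n)) \<longlongrightarrow> 0) (at_right 0)"
      using tendsto_powr'[OF tendsto_ident_at tendsto_const, of 0 "\<alpha> - real n" "{0<..}"] pos
      by (auto simp: eventually_at_filter)
    then show ?thesis
      using lim0[of n "at_right 0"] by (simp add: eventually_at_right_less)
  qed
  then have "g z = 0"
    using holomorphic_fun_eq_0_on_connected[OF g(1) open_UNIV connected_UNIV, of 0 z] by simp
  then show ?thesis using g(2) z by simp
qed

section \<open>Boundary values on the closed strip\<close>

lemma strip_in_closure:
  assumes AB: "A < B" and w: "A \<le> Im w" "Im w \<le> B" and N: "Re w < N"
  shows "w \<in> closure {z. A < Im z \<and> Im z < B \<and> Re z < N}"
  unfolding closure_approachable
proof (intro allI impI)
  fix e :: real assume e: "0 < e"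
  define \<delta> where "\<delta> = min (e/2) ((B - A)/4)"
  have \<delta>: "0 < \<delta>" "\<delta> < e" "\<delta> \<le> (B - A)/4" using e AB by (simp_all add: \<delta>_def min_def)
  \<comment> \<open>The point is pushed vertically towards the middle line, by at most a quarter of
    the width, so its real part stays below \<open>N\<close>.\<close>
  define z where "z = (if Im w < (A + B)/2 then w + \<i> * of_real \<delta> else w - \<i> * of_real \<delta>)"
  have "z \<in> {z. A < Im z \<and> Im z < B \<and> Re z < N}"
    using \<delta> w N AB by (auto simp: z_def field_simps)
  moreover have "dist z w < e" using \<delta> by (auto simp: z_def dist_norm norm_mult)
  ultimately show "\<exists>z\<in>{z. A < Im z \<and> Im z < B \<and> Re z < N}. dist z w < e" by blast
qed

text \<open>On the convex part with \<open>Re w < N\<close> the derivative is at most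
  \<open>M * exp N\<close>, so \<open>F\<close> is Lipschitz there and has limits at the edges. The
  Lipschitz constant grows with \<open>N\<close>, hence the extension is glued from limits at single
  points.\<close>

lemma strip_continuous_extension:
  assumes AB: "A < B"
    and F: "\<And>w. A < Im w \<Longrightarrow> Im w < B \<Longrightarrow> (F has_field_derivative f w) (at w)"
    and bd: "\<And>w. A < Im w \<Longrightarrow> Im w < B \<Longrightarrow> norm (f w) \<le> M * exp (Re w)"
  obtains F' where "continuous_on {w. A \<le> Im w \<and> Im w \<le> B} F'"
    "\<And>w. A < Im w \<Longrightarrow> Im w < B \<Longrightarrow> F' w = F w"
proof -
  let ?S = "{w. A < Im w \<and> Im w < B}" and ?T = "{w. A \<le> Im w \<and> Im w \<le> B}"
  have M: "0 \<le> M"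
    using order_trans[OF norm_ge_zero bd[of "\<i> * of_real ((A + B)/2)"]] AB by simp
  have lim: "\<exists>l. (F \<longlongrightarrow> l) (at w within ?S)" if w: "w \<in> ?T" for w
  proof -
    define N where "N = Re w + 1"
    let ?SN = "{z. A < Im z \<and> Im z < B \<and> Re z < N}"
    have cv: "convex ?SN"
    proof -
      have "?SN = {z. A < Im z} \<inter> {z. Im z < B} \<inter> {z. Re z < N}" by auto
      then show ?thesis
        by (simp add: convex_Int convex_halfspace_Im_gt convex_halfspace_Im_lt convex_halfspace_Re_lt)
    qed
    have "norm (F x - F y) \<le> (M * exp N) * norm (x - y)" if "x \<in> ?SN" "y \<in> ?SN" for x y
    proof (rule field_differentiable_bound[OF cv _ _ that])
      fix z assume z: "z \<in> ?SN"
      then show "(F has_field_derivative f z) (at z within ?SN)"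
        using F has_field_derivative_at_within by blast
      have "M * exp (Re z) \<le> M * exp N" using z M by (intro mult_left_mono) auto
      then show "norm (f z) \<le> M * exp N" using bd[of z] z by auto
    qed
    then have "(M * exp N)-lipschitz_on ?SN F"
      using M by (intro lipschitz_onI) (auto simp: dist_norm)
    then have uc: "uniformly_continuous_on ?SN F" by (rule lipschitz_on_uniformly_continuous)
    have wN: "Re w < N" by (simp add: N_def)
    have "w \<in> closure ?SN" using strip_in_closure[OF AB] w wN by blast
    then obtain l where "(F \<longlongrightarrow> l) (at w within ?SN)"
      using uniformly_continuous_on_extension_at_closure[OF uc] by blast
    moreover have "at w within ?SN = at w within ?S"
      by (rule at_within_nhd[of _ "{z. Re z < N}"]) (use wN open_halfspace_Re_lt in auto)
    ultimately show ?thesis by auto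
  qed
  show thesis
  proof (rule continuous_extension_pointwise[of ?S ?T F])
    show "?T \<subseteq> closure ?S"
    proof
      fix w assume "w \<in> ?T"
      then have "w \<in> closure {z. A < Im z \<and> Im z < B \<and> Re z < Re w + 1}"
        by (intro strip_in_closure[OF AB]) auto
      then show "w \<in> closure ?S" using closure_mono[of "{z. A < Im z \<and> Im z < B \<and> Re z < Re w + 1}" ?S]
        by blast
    qed
    show "continuous_on ?S F"
      using F by (intro continuous_at_imp_continuous_on) (auto intro: DERIV_isCont)
  qed (use lim that in auto)
qed

text \<open>The bounds \<open>ReA\<close> and \<open>ReB\<close> express that \<open>Re F\<close>
  vanishes on both edges. The widths excluded are genuine exceptions: with \<open>A = 0\<close>,
  \<open>B = real n * pi\<close> for positive n and \<open>M = 1\<close>, the function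
  \<open>F w = - \<i> * exp w\<close> satisfies all the estimates, since \<open>Re (F w)\<close> is
  \<open>exp (Re w) * sin (Im w)\<close>.\<close>

lemma strip_rigidity:
  assumes AB: "A < B" "\<And>n::nat. B - A \<noteq> real n * pi"
    and F: "\<And>w. A < Im w \<Longrightarrow> Im w < B \<Longrightarrow> (F has_field_derivative f w) (at w)"
    and bd: "\<And>w. A < Im w \<Longrightarrow> Im w < B \<Longrightarrow> norm (f w) \<le> M * exp (Re w)"
    and ReA: "\<And>w. A < Im w \<Longrightarrow> Im w < B \<Longrightarrow> \<bar>Re (F w)\<bar> \<le> M * exp (Re w) * (Im w - A)"
    and ReB: "\<And>w. A < Im w \<Longrightarrow> Im w < B \<Longrightarrow> \<bar>Re (F w)\<bar> \<le> M * exp (Re w) * (B - Im w)"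
    and w: "A < Im w" "Im w < B"
  shows "f w = 0"
proof -
  let ?S = "{w. A < Im w \<and> Im w < B}" and ?T = "{w. A \<le> Im w \<and> Im w \<le> B}"
  obtain G where G: "continuous_on ?T G" "\<And>w. A < Im w \<Longrightarrow> Im w < B \<Longrightarrow> G w = F w"
    using strip_continuous_extension[OF AB(1) F bd] by blast
  have Re_G: "Re (G w) = 0" if w: "Im w = A \<or> Im w = B" for w
  proof -
    have wT: "w \<in> ?T" using w AB(1) by auto
    have cl: "w \<in> closure ?S"
      using strip_in_closure[OF AB(1), of w "Re w + 1"] wT
        closure_mono[of "{z. A < Im z \<and> Im z < B \<and> Re z < Re w + 1}" ?S] by auto
    have "w \<notin> ?S" using w by auto
    then have nt: "at w within ?S \<noteq> bot"
      using cl by (metis closure_def islimpt_def mem_Collect_eq Un_iff trivial_limit_within)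
    have "(G \<longlongrightarrow> G w) (at w within ?T)" using G(1) wT by (simp add: continuous_on_def)
    then have "(G \<longlongrightarrow> G w) (at w within ?S)" by (rule tendsto_within_subset) auto
    then have l1: "((\<lambda>z. \<bar>Re (G z)\<bar>) \<longlongrightarrow> \<bar>Re (G w)\<bar>) (at w within ?S)" by (intro tendsto_intros)
    define b where "b z = M * exp (Re z) * (if Im w = A then Im z - A else B - Im z)" for z
    have "isCont b w"
      unfolding b_def by (cases "Im w = A") (auto intro!: continuous_intros)
    then have l2: "(b \<longlongrightarrow> b w) (at w within ?S)"
      using continuous_at_imp_continuous_at_within continuous_within by blast
    have "\<forall>\<^sub>F z in at w within ?S. \<bar>Re (G z)\<bar> \<le> b z"
      unfolding eventually_at_filter using G(2) ReA ReB by (auto simp: b_def)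
    then have "\<bar>Re (G w)\<bar> \<le> b w" by (rule tendsto_le[OF nt l2 l1])
    also have "b w = 0" using w by (auto simp: b_def)
    finally show ?thesis by simp
  qed
  define \<alpha> where "\<alpha> = (B - A) / pi"
  have \<alpha>: "0 < \<alpha>" "\<And>n::nat. \<alpha> \<noteq> real n"
    using AB by (auto simp: \<alpha>_def field_simps)
  \<comment> \<open>The inverse of the map from the strip to the upper half-plane. The rotation by
    \<open>- \<i>\<close> brings the closed half-plane to \<open>Re \<ge> 0\<close>, away from the
    branch cut of \<open>Ln\<close>, so that \<open>\<Lambda>\<close> is continuous up to the real
    axis except at 0. The factor \<open>\<alpha>\<close> turns arguments between - pi/2 and pi/2
    into the width \<open>B - A\<close>.\<close>
  define \<Lambda> where "\<Lambda> \<zeta> = of_real \<alpha> * Ln (- \<i> * \<zeta>) + \<i> * of_real ((A + B)/2)" for \<zeta>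
  have Im_\<Lambda>: "Im (\<Lambda> \<zeta>) = \<alpha> * Im (Ln (- \<i> * \<zeta>)) + (A + B)/2" for \<zeta>
    by (simp add: \<Lambda>_def)
  have half: "\<alpha> * (pi/2) = (B - A)/2" by (simp add: \<alpha>_def)
  have \<Lambda>_in: "A < Im (\<Lambda> \<zeta>)" "Im (\<Lambda> \<zeta>) < B" if "0 < Im \<zeta>" for \<zeta>
  proof -
    have "\<bar>Im (Ln (- \<i> * \<zeta>))\<bar> < pi/2" using that by (intro Re_Ln_pos_lt_imp) simp
    then have "\<alpha> * \<bar>Im (Ln (- \<i> * \<zeta>))\<bar> < \<alpha> * (pi/2)" using \<alpha>(1) by (rule mult_strict_left_mono)
    then have "\<bar>\<alpha> * Im (Ln (- \<i> * \<zeta>))\<bar> < (B - A)/2" unfolding half using \<alpha>(1) by (simp add: abs_mult)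
    then show "A < Im (\<Lambda> \<zeta>)" "Im (\<Lambda> \<zeta>) < B" unfolding Im_\<Lambda> by (auto simp: field_simps)
  qed
  have \<Lambda>_T: "\<Lambda> \<zeta> \<in> ?T" if "0 \<le> Im \<zeta>" "\<zeta> \<noteq> 0" for \<zeta>
  proof -
    have "\<bar>Im (Ln (- \<i> * \<zeta>))\<bar> \<le> pi/2" using that by (subst Re_Ln_pos_le) auto
    then have "\<alpha> * \<bar>Im (Ln (- \<i> * \<zeta>))\<bar> \<le> \<alpha> * (pi/2)" using \<alpha>(1) by (intro mult_left_mono) auto
    then have "\<bar>\<alpha> * Im (Ln (- \<i> * \<zeta>))\<bar> \<le> (B - A)/2" unfolding half using \<alpha>(1) by (simp add: abs_mult)
    then show ?thesis by (auto simp: Im_\<Lambda> field_simps)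
  qed
  have \<Lambda>_bdry: "Im (\<Lambda> \<zeta>) = A \<or> Im (\<Lambda> \<zeta>) = B" if "Im \<zeta> = 0" "\<zeta> \<noteq> 0" for \<zeta>
  proof -
    have "\<bar>Im (Ln (- \<i> * \<zeta>))\<bar> \<le> pi/2" "\<not> \<bar>Im (Ln (- \<i> * \<zeta>))\<bar> < pi/2"
      using that Re_Ln_pos_le[of "- \<i> * \<zeta>"] Re_Ln_pos_lt[of "- \<i> * \<zeta>"] by auto
    then have "Im (Ln (- \<i> * \<zeta>)) = pi/2 \<or> Im (Ln (- \<i> * \<zeta>)) = - (pi/2)" by linarith
    then show ?thesis
    proof
      assume "Im (Ln (- \<i> * \<zeta>)) = pi/2"
      then have "Im (\<Lambda> \<zeta>) = B" unfolding Im_\<Lambda> using half by (simp add: field_simps)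
      then show ?thesis ..
    next
      assume "Im (Ln (- \<i> * \<zeta>)) = - (pi/2)"
      then have "Im (\<Lambda> \<zeta>) = A" unfolding Im_\<Lambda> using half by (simp add: field_simps)
      then show ?thesis ..
    qed
  qed
  have nonpos: "- \<i> * \<zeta> \<notin> \<real>\<^sub>\<le>\<^sub>0" if "0 \<le> Im \<zeta>" "\<zeta> \<noteq> 0" for \<zeta>
    using that by (auto simp: complex_nonpos_Reals_iff complex_eq_iff)
  have d\<Lambda>: "(\<Lambda> has_field_derivative of_real \<alpha> / \<zeta>) (at \<zeta>)" if "0 \<le> Im \<zeta>" "\<zeta> \<noteq> 0" for \<zeta>
    unfolding \<Lambda>_def using nonpos[OF that] that(2)
    by (auto intro!: derivative_eq_intros simp: field_simps)
  have exp_\<Lambda>: "exp (Re (\<Lambda> \<zeta>)) = norm \<zeta> powr \<alpha>" if "\<zeta> \<noteq> 0" for \<zeta>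
    using that by (simp add: \<Lambda>_def powr_def norm_mult)
  \<comment> \<open>The factor \<open>\<i>\<close> makes the purely imaginary boundary values of
    \<open>G\<close> real, as Schwarz reflection demands.\<close>
  define P where "P \<zeta> = (if 0 \<le> Im \<zeta> then \<i> * G (\<Lambda> \<zeta>) else cnj (\<i> * G (\<Lambda> (cnj \<zeta>))))" for \<zeta>
  have dH: "((\<lambda>\<zeta>. \<i> * G (\<Lambda> \<zeta>)) has_field_derivative \<i> * f (\<Lambda> \<zeta>) * (of_real \<alpha> / \<zeta>)) (at \<zeta>)"
    if "0 < Im \<zeta>" for \<zeta>
  proof (rule has_field_derivative_transform_within_open[where S = "{\<zeta>. 0 < Im \<zeta>}"])
    have nz: "\<zeta> \<noteq> 0" using that by auto
    have "((\<lambda>\<zeta>. F (\<Lambda> \<zeta>)) has_field_derivative f (\<Lambda> \<zeta>) * (of_real \<alpha> / \<zeta>)) (at \<zeta>)"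
      using F[OF \<Lambda>_in[OF that]] d\<Lambda>[of \<zeta>] that nz by (intro DERIV_chain2) auto
    from DERIV_cmult[OF this, of \<i>]
    show "((\<lambda>\<zeta>. \<i> * F (\<Lambda> \<zeta>)) has_field_derivative \<i> * f (\<Lambda> \<zeta>) * (of_real \<alpha> / \<zeta>)) (at \<zeta>)"
      by (simp add: mult.assoc)
  qed (use that G(2) \<Lambda>_in open_halfspace_Im_gt in auto)
  have P_hol: "P holomorphic_on - {0}"
    unfolding P_def
  proof (rule Schwarz_reflection)
    show "(\<lambda>\<zeta>. \<i> * G (\<Lambda> \<zeta>)) holomorphic_on - {0} \<inter> {z. 0 < Im z}"
      using dH by (intro holomorphic_onI) (auto simp: field_differentiable_def intro: has_field_derivative_at_within)
    have "continuous_on (- {0} \<inter> {z. 0 \<le> Im z}) \<Lambda>"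
      using d\<Lambda> by (intro continuous_at_imp_continuous_on) (auto intro: DERIV_isCont)
    then have "continuous_on (- {0} \<inter> {z. 0 \<le> Im z}) (\<lambda>\<zeta>. G (\<Lambda> \<zeta>))"
      by (rule continuous_on_compose2[OF G(1)]) (use \<Lambda>_T in auto)
    then show "continuous_on (- {0} \<inter> {z. 0 \<le> Im z}) (\<lambda>\<zeta>. \<i> * G (\<Lambda> \<zeta>))"
      by (intro continuous_intros)
    show "\<i> * G (\<Lambda> z) \<in> \<real>" if "z \<in> - {0}" "z \<in> \<real>" for z
      using that Re_G[OF \<Lambda>_bdry[of z]] by (auto simp: complex_is_Real_iff)
  qed auto
  have dP: "(P has_field_derivative \<i> * f (\<Lambda> \<zeta>) * (of_real \<alpha> / \<zeta>)) (at \<zeta>)" if "0 < Im \<zeta>" for \<zeta>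
    by (rule has_field_derivative_transform_within_open[OF dH[OF that] open_halfspace_Im_gt[of 0]])
       (use that in \<open>auto simp: P_def\<close>)
  have P_cnj: "P \<zeta> = (cnj \<circ> P \<circ> cnj) \<zeta>" if "Im \<zeta> < 0" for \<zeta>
    using that by (simp add: P_def)
  have dP_neg: "deriv P \<zeta> = cnj (deriv P (cnj \<zeta>))" if "Im \<zeta> < 0" for \<zeta>
  proof (rule DERIV_imp_deriv)
    have "(P has_field_derivative deriv P (cnj \<zeta>)) (at (cnj \<zeta>))"
      using dP[of "cnj \<zeta>"] that DERIV_imp_deriv by fastforce
    then have "((cnj \<circ> P \<circ> cnj) has_field_derivative cnj (deriv P (cnj \<zeta>))) (at \<zeta>)"
      by (rule has_field_derivative_cnj_cnj)
    then show "(P has_field_derivative cnj (deriv P (cnj \<zeta>))) (at \<zeta>)"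
      by (rule has_field_derivative_transform_within_open[OF _ open_halfspace_Im_lt[of 0]])
         (use that P_cnj in auto)
  qed
  \<comment> \<open>K is, up to a constant factor, f in the coordinate \<open>\<Lambda>\<close>; unlike P it is bounded near 0 without further work.\<close>
  define K where "K \<zeta> = \<zeta> * deriv P \<zeta>" for \<zeta>
  have K_hol: "K holomorphic_on - {0}"
    unfolding K_def by (intro holomorphic_intros holomorphic_deriv P_hol) auto
  have K_pos: "norm (K \<zeta>) \<le> \<alpha> * M * norm \<zeta> powr \<alpha>" if "0 < Im \<zeta>" for \<zeta>
  proof -
    have nz: "\<zeta> \<noteq> 0" using that by auto
    have "K \<zeta> = \<i> * of_real \<alpha> * f (\<Lambda> \<zeta>)" using DERIV_imp_deriv[OF dP[OF that]] nz by (simp add: K_def)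
    then have "norm (K \<zeta>) = \<alpha> * norm (f (\<Lambda> \<zeta>))" using \<alpha>(1) by (simp add: norm_mult)
    also have "\<dots> \<le> \<alpha> * (M * exp (Re (\<Lambda> \<zeta>)))"
      using \<alpha>(1) bd[OF \<Lambda>_in[OF that]] by (intro mult_left_mono) auto
    finally show ?thesis using exp_\<Lambda>[OF nz] by simp
  qed
  have K_neg: "norm (K \<zeta>) \<le> \<alpha> * M * norm \<zeta> powr \<alpha>" if "Im \<zeta> < 0" for \<zeta>
  proof -
    have "K \<zeta> = cnj (K (cnj \<zeta>))" using dP_neg[OF that] by (simp add: K_def)
    then show ?thesis using K_pos[of "cnj \<zeta>"] that by simp
  qed
  have K_bd: "norm (K \<zeta>) \<le> \<alpha> * M * norm \<zeta> powr \<alpha>" if nz: "\<zeta> \<noteq> 0" for \<zeta>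
  proof (cases "Im \<zeta> = 0")
    case False
    then show ?thesis using K_pos K_neg by (metis linorder_neqE_linordered_idom)
  next
    case True
    \<comment> \<open>The estimates for \<open>f\<close> hold in the open strip, so on the real axis
      the bound is reached by continuity from above.\<close>
    define s where "s n = \<zeta> + \<i> * of_real (1 / real (Suc n))" for n
    have "(\<lambda>n. 1 / real (Suc n)) \<longlonglongrightarrow> 0" using LIMSEQ_Suc[OF lim_1_over_n] by simp
    then have "s \<longlonglongrightarrow> \<zeta> + \<i> * of_real 0" unfolding s_def by (intro tendsto_intros)
    then have s: "s \<longlonglongrightarrow> \<zeta>" by simp
    have "isCont K \<zeta>"
      using holomorphic_on_imp_continuous_on[OF K_hol] nz
      by (simp add: continuous_on_eq_continuous_at open_Compl)
    then have "(\<lambda>n. norm (K (s n))) \<longlonglongrightarrow> norm (K \<zeta>)"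
      using s by (intro tendsto_norm isCont_tendsto_compose[of \<zeta> K])
    moreover have "(\<lambda>n. \<alpha> * M * norm (s n) powr \<alpha>) \<longlonglongrightarrow> \<alpha> * M * norm \<zeta> powr \<alpha>"
      using nz by (intro tendsto_intros s) auto
    moreover have "norm (K (s n)) \<le> \<alpha> * M * norm (s n) powr \<alpha>" for n
      using True by (intro K_pos) (simp add: s_def)
    ultimately show ?thesis by (intro LIMSEQ_le) auto
  qed
  \<comment> \<open>The preimage of \<open>w\<close> under \<open>\<Lambda>\<close>; there
    \<open>deriv P\<close> is a nonzero multiple of \<open>f w\<close>.\<close>
  define \<zeta> where "\<zeta> = \<i> * exp ((w - \<i> * of_real ((A + B)/2)) / of_real \<alpha>)"
  have \<zeta>: "\<zeta> \<noteq> 0" "- \<i> * \<zeta> = exp ((w - \<i> * of_real ((A + B)/2)) / of_real \<alpha>)"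
    by (auto simp: \<zeta>_def)
  have im: "\<bar>Im ((w - \<i> * of_real ((A + B)/2)) / of_real \<alpha>)\<bar> < pi/2"
  proof -
    have "\<bar>Im w - (A + B)/2\<bar> < \<alpha> * (pi/2)" unfolding half using w by (auto simp: field_simps abs_less_iff)
    then show ?thesis using \<alpha>(1) by (simp add: Im_divide_of_real field_simps)
  qed
  have "Ln (- \<i> * \<zeta>) = (w - \<i> * of_real ((A + B)/2)) / of_real \<alpha>"
    unfolding \<zeta>(2) using im pi_gt_zero by (intro Ln_exp) linarith+
  then have \<Lambda>\<zeta>: "\<Lambda> \<zeta> = w" using \<alpha>(1) by (simp add: \<Lambda>_def)
  have "0 < Re (- \<i> * \<zeta>)"
    unfolding \<zeta>(2) Re_exp using im
    by (intro mult_pos_pos exp_gt_zero cos_gt_zero_pi) (simp_all only: abs_less_iff, linarith+)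
  then have "0 < Im \<zeta>" by simp
  then have "\<i> * f w * (of_real \<alpha> / \<zeta>) = deriv P \<zeta>" using DERIV_imp_deriv[OF dP] \<Lambda>\<zeta> by metis
  also have "\<dots> = 0"
    using punctured_plane_eq_0_of_powr_growth[OF K_hol K_bd \<alpha> \<zeta>(1)] \<zeta>(1) by (simp add: K_def)
  finally show ?thesis using \<zeta>(1) \<alpha>(1) by simp
qed

section \<open>Translates of a flow\<close>

text \<open>For translates of a flow no common domain is available: \<open>f n\<close> is
  holomorphic and bounded on \<open>U i\<close> only from an index on that depends on
  \<open>i\<close>. Montel's theorem is applied on each \<open>U i\<close> separately, and a
  diagonal subsequence serves all of them.\<close>

lemma Montel_exhaustion:
  fixes f :: "nat \<Rightarrow> complex \<Rightarrow> complex" and U :: "nat \<Rightarrow> complex set"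
  assumes opn: "\<And>i. open (U i)" and mono: "\<And>i j. i \<le> j \<Longrightarrow> U i \<subseteq> U j"
    and hol: "\<And>i. \<forall>\<^sub>F n in sequentially. f n holomorphic_on U i"
    and bdd: "\<And>i. \<exists>B. \<forall>\<^sub>F n in sequentially. \<forall>z\<in>U i. norm (f n z) \<le> B"
  obtains k h where "strict_mono (k :: nat \<Rightarrow> nat)" "h holomorphic_on (\<Union>i. U i)"
    "\<And>K. compact K \<Longrightarrow> K \<subseteq> (\<Union>i. U i) \<Longrightarrow> uniform_limit K (\<lambda>n. f (k n)) h sequentially"
proof -
  have "\<exists>B N. \<forall>n\<ge>N. f n holomorphic_on U i \<and> (\<forall>z\<in>U i. norm (f n z) \<le> B)" for i
    using hol[of i] bdd[of i] unfolding eventually_sequentially by (metis le_trans linear)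
  then obtain B N where BN: "\<And>i n. N i \<le> n \<Longrightarrow> f n holomorphic_on U i"
    "\<And>i n z. N i \<le> n \<Longrightarrow> z \<in> U i \<Longrightarrow> norm (f n z) \<le> B i"
    by metis
  \<comment> \<open>The zero function fills the indices before \<open>N i\<close>, so that the
    entire sequence lies in one bounded family on \<open>U i\<close>; the limit is not
    affected.\<close>
  define \<Phi> where "\<Phi> i n = (if N i \<le> n then f n else (\<lambda>_. 0))" for i n
  define P where "P i r \<longleftrightarrow> (\<exists>h. h holomorphic_on U i \<and>
      (\<forall>K. compact K \<longrightarrow> K \<subseteq> U i \<longrightarrow> uniform_limit K (\<lambda>n. \<Phi> i (r n)) h sequentially))"
    for i and r :: "nat \<Rightarrow> nat"
  obtain k where k: "strict_mono (k :: nat \<Rightarrow> nat)" "\<And>i. P i (id \<circ> k)"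
  proof (rule subsequence_diagonalization_lemma[of P id])
    fix i and r :: "nat \<Rightarrow> nat"
    let ?H = "{h. h holomorphic_on U i \<and> (\<forall>z\<in>U i. norm (h z) \<le> max 0 (B i))}"
    show "\<exists>k. strict_mono (k :: nat \<Rightarrow> nat) \<and> P i (r \<circ> k)"
    proof (rule Montel[of "U i" ?H "\<lambda>n. \<Phi> i (r n)"])
      show "range (\<lambda>n. \<Phi> i (r n)) \<subseteq> ?H"
        using BN by (auto simp: \<Phi>_def le_max_iff_disj)
      show "\<exists>B. \<forall>h\<in>?H. \<forall>z\<in>K. norm (h z) \<le> B" if "K \<subseteq> U i" for K
        using that by (intro exI[of _ "max 0 (B i)"]) auto
      fix h and k :: "nat \<Rightarrow> nat"
      assume "h holomorphic_on U i" "strict_mono k"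
        "\<And>K. compact K \<Longrightarrow> K \<subseteq> U i \<Longrightarrow> uniform_limit K ((\<lambda>n. \<Phi> i (r n)) \<circ> k) h sequentially"
      then show ?thesis unfolding P_def by (auto simp: o_def)
    qed (simp_all add: opn)
  next
    fix i r and k1 k2 :: "nat \<Rightarrow> nat" and N0
    assume P1: "P i (r \<circ> k1)" and sub: "\<And>j. N0 \<le> j \<Longrightarrow> \<exists>j'\<ge>j. k2 j = k1 j'"
    obtain h where h: "h holomorphic_on U i"
      "\<And>K. compact K \<Longrightarrow> K \<subseteq> U i \<Longrightarrow> uniform_limit K (\<lambda>n. \<Phi> i ((r \<circ> k1) n)) h sequentially"
      using P1 unfolding P_def by blast
    have "uniform_limit K (\<lambda>n. \<Phi> i ((r \<circ> k2) n)) h sequentially" if K: "compact K" "K \<subseteq> U i" for K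
      unfolding uniform_limit_sequentially_iff
    proof (intro allI impI)
      fix e :: real assume "0 < e"
      then obtain N1 where N1: "\<And>n x. N1 \<le> n \<Longrightarrow> x \<in> K \<Longrightarrow> dist (\<Phi> i ((r \<circ> k1) n) x) (h x) < e"
        using h(2)[OF K] unfolding uniform_limit_sequentially_iff by blast
      show "\<exists>N. \<forall>n\<ge>N. \<forall>x\<in>K. dist (\<Phi> i ((r \<circ> k2) n) x) (h x) < e"
      proof (intro exI allI impI ballI)
        fix n x assume n: "max N0 N1 \<le> n" and x: "x \<in> K"
        then obtain j' where "j' \<ge> n" "k2 n = k1 j'" using sub[of n] by auto
        then show "dist (\<Phi> i ((r \<circ> k2) n) x) (h x) < e" using N1[of j' x] n x by auto
      qed
    qed
    then show "P i (r \<circ> k2)" unfolding P_def using h(1) by blast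
  qed blast
  have "\<exists>h. h holomorphic_on U i \<and>
      (\<forall>K. compact K \<longrightarrow> K \<subseteq> U i \<longrightarrow> uniform_limit K (\<lambda>n. f (k n)) h sequentially)" for i
  proof -
    obtain h where h: "h holomorphic_on U i"
      "\<And>K. compact K \<Longrightarrow> K \<subseteq> U i \<Longrightarrow> uniform_limit K (\<lambda>n. \<Phi> i (k n)) h sequentially"
      using k(2)[of i] unfolding P_def by auto
    have "\<forall>\<^sub>F n in sequentially. \<forall>x\<in>K. \<Phi> i (k n) x = f (k n) x" for K
      using eventually_ge_at_top[of "N i"]
      by eventually_elim (use seq_suble[OF k(1)] in \<open>auto simp: \<Phi>_def intro: order_trans\<close>)
    then have "uniform_limit K (\<lambda>n. f (k n)) h sequentially" if "compact K" "K \<subseteq> U i" for K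
      using h(2)[OF that] uniform_limit_cong[of K "\<lambda>n. \<Phi> i (k n)" "\<lambda>n. f (k n)" sequentially h h] by blast
    then show ?thesis using h(1) by blast
  qed
  then obtain hh where hh: "\<And>i. hh i holomorphic_on U i"
    "\<And>i K. compact K \<Longrightarrow> K \<subseteq> U i \<Longrightarrow> uniform_limit K (\<lambda>n. f (k n)) (hh i) sequentially"
    by metis
  \<comment> \<open>As a pointwise limit, \<open>h\<close> agrees with every local limit
    \<open>hh i\<close>, so these need not be compared with each other.\<close>
  define h where "h z = lim (\<lambda>n. f (k n) z)" for z
  have h_eq: "h z = hh i z" if "z \<in> U i" for i z
  proof -
    have "uniform_limit {z} (\<lambda>n. f (k n)) (hh i) sequentially" using that by (intro hh(2)) auto
    then have "(\<lambda>n. f (k n) z) \<longlonglongrightarrow> hh i z" by (rule tendsto_uniform_limitI) simp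
    then show ?thesis unfolding h_def by (rule limI)
  qed
  show thesis
  proof (rule that[OF k(1)])
    have "h holomorphic_on U i" for i
      using hh(1)[of i] holomorphic_cong[of "U i" "U i" h "hh i"] h_eq by simp
    then show "h holomorphic_on (\<Union>i. U i)"
      by (intro holomorphic_on_UN_open opn)
    fix K assume K: "compact K" "K \<subseteq> (\<Union>i. U i)"
    obtain I where I: "finite I" "K \<subseteq> (\<Union>i\<in>I. U i)"
      by (rule compactE_image[OF K(1), of UNIV U]) (use opn K(2) in auto)
    define i where "i = Max (insert 0 I)"
    have i: "j \<le> i" if "j \<in> I" for j using that I(1) by (simp add: i_def)
    have Ki: "K \<subseteq> U i" using I(2) mono[OF i] by blast
    show "uniform_limit K (\<lambda>n. f (k n)) h sequentially"
      using hh(2)[OF K(1) Ki] h_eq Ki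
      by (subst uniform_limit_cong'[of K "\<lambda>n. f (k n)" "\<lambda>n. f (k n)" h "hh i"]) auto
  qed
qed

section \<open>The flow in logarithmic coordinates, and its first estimates at the boundary\<close>

definition log_domain :: "real \<Rightarrow> (real \<Rightarrow> real) \<Rightarrow> (real \<Rightarrow> real) \<Rightarrow> complex set" where
  "log_domain S0 \<tau>0 \<tau>1 = {w. S0 < Re w \<and> \<tau>0 (Re w) < Im w \<and> Im w < \<tau>1 (Re w)}"

lemma open_log_domain:
  assumes "continuous_on {S0<..} \<tau>0" "continuous_on {S0<..} \<tau>1"
  shows "open (log_domain S0 \<tau>0 \<tau>1)"
proof -
  let ?H = "{w. S0 < Re w}"
  have H: "open ?H" by (rule open_halfspace_Re_gt)
  have c: "continuous_on ?H (\<lambda>w. \<tau> (Re w))" if "continuous_on {S0<..} \<tau>" for \<tau>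
    by (rule continuous_on_compose2[OF that]) (auto intro!: continuous_intros)
  have "open {w \<in> ?H. f w < h w}" if "continuous_on ?H f" "continuous_on ?H h" for f h :: "complex \<Rightarrow> real"
    using open_Collect_less_Int[OF that] H by (metis open_Int)
  then have "open {w \<in> ?H. \<tau>0 (Re w) < Im w}" "open {w \<in> ?H. Im w < \<tau>1 (Re w)}"
    using c[OF assms(1)] c[OF assms(2)] by (blast intro: continuous_on_Im continuous_on_id)+
  moreover have "log_domain S0 \<tau>0 \<tau>1 = {w \<in> ?H. \<tau>0 (Re w) < Im w} \<inter> {w \<in> ?H. Im w < \<tau>1 (Re w)}"
    by (auto simp: log_domain_def)
  ultimately show ?thesis by auto
qed

text \<open>The intended instance is \<open>u w = \<psi> (exp w)\<close>. The factor
  \<open>exp (Re w)\<close> in the gradient bound is the modulus of the derivative of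
  \<open>exp\<close>, so \<open>M\<close> bounds the original velocity.\<close>

locale log_flow =
  fixes S0 M :: real and \<tau>0 \<tau>1 :: "real \<Rightarrow> real" and u :: "complex \<Rightarrow> real" and g :: "complex \<Rightarrow> complex"
  assumes cont: "continuous_on {S0<..} \<tau>0" "continuous_on {S0<..} \<tau>1"
    and cgrad: "cgrad_on u g (log_domain S0 \<tau>0 \<tau>1)"
    and gradient_bound: "\<And>w. w \<in> log_domain S0 \<tau>0 \<tau>1 \<Longrightarrow> norm (g w) \<le> M * exp (Re w)"
    and trace: "\<And>b. S0 < Re b \<Longrightarrow> Im b \<in> {\<tau>0 (Re b), \<tau>1 (Re b)} \<Longrightarrow>
      (u \<longlongrightarrow> 0) (at b within log_domain S0 \<tau>0 \<tau>1)"

lemma cnj_log_domain: "cnj w \<in> log_domain S0 \<tau>0 \<tau>1 \<longleftrightarrow> w \<in> log_domain S0 (\<lambda>s. - \<tau>1 s) (\<lambda>s. - \<tau>0 s)"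
  by (auto simp: log_domain_def)

lemma cgrad_on_cnj:
  assumes "open E" "cgrad_on u g E"
  shows "cgrad_on (\<lambda>w. u (cnj w)) (\<lambda>w. cnj (g (cnj w))) (cnj ` E)"
proof -
  have E: "cnj z \<in> E" if "z \<in> cnj ` E" for z using that by auto
  have "(cnj \<circ> g \<circ> cnj) holomorphic_on cnj ` E"
  proof (rule holomorphic_onI)
    fix z assume "z \<in> cnj ` E"
    then have "g field_differentiable at (cnj z)"
      using holomorphic_on_imp_differentiable_at[OF _ assms(1) E] assms(2) by (simp add: cgrad_on_def)
    then show "(cnj \<circ> g \<circ> cnj) field_differentiable at z within cnj ` E"
      by (rule field_differentiable_at_within[OF field_differentiable_cnj_cnj])
  qed
  moreover have "((\<lambda>w. u (cnj w)) has_derivative (\<lambda>h. Re (cnj (g (cnj w)) * h))) (at w)"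
    if "w \<in> cnj ` E" for w
  proof -
    have "(u has_derivative (\<lambda>h. Re (g (cnj w) * h))) (at (cnj w))"
      using assms(2) E[OF that] unfolding cgrad_on_def by blast
    then have "((\<lambda>w. u (cnj w)) has_derivative (\<lambda>h. Re (g (cnj w) * cnj h))) (at w)"
      by (rule has_derivative_compose[rotated]) (auto intro!: derivative_eq_intros)
    moreover have "Re (g (cnj w) * cnj h) = Re (cnj (g (cnj w)) * h)" for h by simp
    ultimately show ?thesis by simp
  qed
  ultimately show ?thesis unfolding cgrad_on_def by (simp add: o_def)
qed

lemma cnj_image_log_domain: "cnj ` log_domain S0 \<tau>0 \<tau>1 = log_domain S0 (\<lambda>s. - \<tau>1 s) (\<lambda>s. - \<tau>0 s)"
  by (rule set_eqI) (metis cnj_log_domain complex_cnj_cnj image_iff)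

text \<open>Conjugation exchanges the two boundary curves; estimates at the upper curve are thereby
  those at the lower curve of the conjugate flow.\<close>

lemma log_flow_cnj:
  assumes "log_flow S0 M \<tau>0 \<tau>1 u g"
  shows "log_flow S0 M (\<lambda>s. - \<tau>1 s) (\<lambda>s. - \<tau>0 s) (\<lambda>w. u (cnj w)) (\<lambda>w. cnj (g (cnj w)))"
proof -
  interpret log_flow S0 M \<tau>0 \<tau>1 u g by fact
  show ?thesis
  proof
    show "cgrad_on (\<lambda>w. u (cnj w)) (\<lambda>w. cnj (g (cnj w))) (log_domain S0 (\<lambda>s. - \<tau>1 s) (\<lambda>s. - \<tau>0 s))"
      using cgrad_on_cnj[OF open_log_domain[OF cont] cgrad] by (simp add: cnj_image_log_domain)
    show "continuous_on {S0<..} (\<lambda>s. - \<tau>1 s)" "continuous_on {S0<..} (\<lambda>s. - \<tau>0 s)"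
      by (intro continuous_on_minus cont)+
    show "norm (cnj (g (cnj w))) \<le> M * exp (Re w)" if "w \<in> log_domain S0 (\<lambda>s. - \<tau>1 s) (\<lambda>s. - \<tau>0 s)" for w
      using gradient_bound[of "cnj w"] that by (simp add: cnj_log_domain)
    fix b assume "S0 < Re b" "Im b \<in> {- \<tau>1 (Re b), - \<tau>0 (Re b)}"
    then have u0: "(u \<longlongrightarrow> 0) (at (cnj b) within log_domain S0 \<tau>0 \<tau>1)" by (intro trace) auto
    have "filterlim cnj (at (cnj b) within log_domain S0 \<tau>0 \<tau>1)
        (at b within log_domain S0 (\<lambda>s. - \<tau>1 s) (\<lambda>s. - \<tau>0 s))"
      unfolding filterlim_at by (auto simp: eventually_at_filter cnj_log_domain intro!: tendsto_intros)
    then show "((\<lambda>w. u (cnj w)) \<longlongrightarrow> 0) (at b within log_domain S0 (\<lambda>s. - \<tau>1 s) (\<lambda>s. - \<tau>0 s))"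
      by (rule filterlim_compose[OF u0])
  qed
qed

context log_flow
begin

abbreviation "D \<equiv> log_domain S0 \<tau>0 \<tau>1"

lemma open_D: "open D"
  by (rule open_log_domain[OF cont])

text \<open>The vertical segment from the lower curve to \<open>w\<close> lies in the domain, and
  \<open>u\<close> starts from 0 on it; the mean value theorem is applied from a height
  \<open>y\<close> just above the curve, and then \<open>y\<close> tends to the curve.\<close>

lemma lower_distance_bound:
  assumes w: "w \<in> D"
  shows "\<bar>u w\<bar> \<le> M * exp (Re w) * (Im w - \<tau>0 (Re w))"
proof -
  define s t where "s = Re w" and "t = Im w"
  have st: "S0 < s" "\<tau>0 s < t" "t < \<tau>1 s" using w by (auto simp: log_domain_def s_def t_def)
  have in_D: "Complex s y \<in> D" if "\<tau>0 s < y" "y \<le> t" for y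
    using st that by (auto simp: log_domain_def)
  have C: "((\<lambda>y. Complex s y) has_vector_derivative \<i>) F" for F
    unfolding has_vector_derivative_def Complex_eq by (auto intro!: derivative_eq_intros simp: scaleR_conv_of_real mult.commute)
  have du: "((\<lambda>y. u (Complex s y)) has_real_derivative - Im (g (Complex s y))) (at y)"
    if "\<tau>0 s < y" "y \<le> t" for y
  proof -
    have "(u has_derivative (\<lambda>h. Re (g (Complex s y) * h))) (at (Complex s y))"
      using cgrad in_D[OF that] unfolding cgrad_on_def by blast
    from has_derivative_compose[OF C[unfolded has_vector_derivative_def] this]
    moreover have "(\<lambda>x. Re (g (Complex s y) * (x *\<^sub>R \<i>))) = (*) (- Im (g (Complex s y)))"
      by (auto simp: mult.commute)
    ultimately show ?thesis by (simp add: has_field_derivative_def)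
  qed
  have diff: "\<bar>u (Complex s t) - u (Complex s y)\<bar> \<le> M * exp s * (t - y)" if y: "\<tau>0 s < y" "y < t" for y
  proof -
    obtain z where z: "y < z" "z < t" "u (Complex s t) - u (Complex s y) = (t - y) * - Im (g (Complex s z))"
      using MVT2[OF y(2), of "\<lambda>y. u (Complex s y)" "\<lambda>y. - Im (g (Complex s y))"] du y by auto
    have "\<bar>Im (g (Complex s z))\<bar> \<le> M * exp s"
      using order_trans[OF abs_Im_le_cmod gradient_bound[OF in_D[of z]]] y z by simp
    then have "(t - y) * \<bar>Im (g (Complex s z))\<bar> \<le> (t - y) * (M * exp s)"
      using y by (intro mult_left_mono) auto
    then show ?thesis using y by (simp add: z(3) abs_mult mult.commute)
  qed
  have f: "filterlim (Complex s) (at (Complex s (\<tau>0 s)) within D) (at_right (\<tau>0 s))"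
    unfolding filterlim_at
  proof
    show "(Complex s \<longlongrightarrow> Complex s (\<tau>0 s)) (at_right (\<tau>0 s))" by (intro tendsto_intros)
    have "\<forall>\<^sub>F y in at_right (\<tau>0 s). y < t" 
      using eventually_at_right_real[OF st(2)] by eventually_elim auto
    moreover have "\<forall>\<^sub>F y in at_right (\<tau>0 s). \<tau>0 s < y" by (simp add: eventually_at_right_less)
    ultimately show "\<forall>\<^sub>F y in at_right (\<tau>0 s). Complex s y \<in> D \<and> Complex s y \<noteq> Complex s (\<tau>0 s)"
      by eventually_elim (use in_D in auto)
  qed
  have u0: "((\<lambda>y. u (Complex s y)) \<longlongrightarrow> 0) (at_right (\<tau>0 s))"
    by (rule filterlim_compose[OF trace f]) (use st in auto)
  have "\<bar>u (Complex s t) - 0\<bar> \<le> M * exp s * (t - \<tau>0 s)"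
  proof (rule tendsto_le[OF trivial_limit_at_right_real])
    show "((\<lambda>y. M * exp s * (t - y)) \<longlongrightarrow> M * exp s * (t - \<tau>0 s)) (at_right (\<tau>0 s))"
      by (intro tendsto_intros)
    show "((\<lambda>y. \<bar>u (Complex s t) - u (Complex s y)\<bar>) \<longlongrightarrow> \<bar>u (Complex s t) - 0\<bar>) (at_right (\<tau>0 s))"
      by (intro tendsto_intros u0)
    have "\<forall>\<^sub>F y in at_right (\<tau>0 s). y < t" 
      using eventually_at_right_real[OF st(2)] by eventually_elim auto
    moreover have "\<forall>\<^sub>F y in at_right (\<tau>0 s). \<tau>0 s < y" by (simp add: eventually_at_right_less)
    ultimately show "\<forall>\<^sub>F y in at_right (\<tau>0 s). \<bar>u (Complex s t) - u (Complex s y)\<bar> \<le> M * exp s * (t - y)"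
      by eventually_elim (rule diff)
  qed
  then show ?thesis by (simp add: s_def t_def)
qed

lemma upper_distance_bound:
  assumes "w \<in> D"
  shows "\<bar>u w\<bar> \<le> M * exp (Re w) * (\<tau>1 (Re w) - Im w)"
proof -
  interpret c: log_flow S0 M "\<lambda>s. - \<tau>1 s" "\<lambda>s. - \<tau>0 s" "\<lambda>w. u (cnj w)" "\<lambda>w. cnj (g (cnj w))"
    by (rule log_flow_cnj[OF log_flow_axioms])
  show ?thesis using c.lower_distance_bound[of "cnj w"] assms by (simp flip: cnj_log_domain)
qed

end

section \<open>Rescaled translates and their limit on the exact strip\<close>

lemma cgrad_on_translate:
  assumes v: "cgrad_on v g E" and E: "\<And>w. w \<in> E' \<Longrightarrow> w + c \<in> E"
  shows "cgrad_on (\<lambda>w. a * v (w + c)) (\<lambda>w. of_real a * g (w + c)) E'"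
proof -
  have "(g \<circ> (\<lambda>w. w + c)) holomorphic_on E'"
    by (rule holomorphic_on_compose_gen[where t = E])
       (use v E in \<open>auto simp: cgrad_on_def intro!: holomorphic_intros\<close>)
  then have "(\<lambda>w. g (w + c)) holomorphic_on E'" by (simp add: o_def)
  moreover have "((\<lambda>w. a * v (w + c)) has_derivative (\<lambda>h. Re (of_real a * g (w + c) * h))) (at w)"
    if "w \<in> E'" for w
  proof -
    have "(v has_derivative (\<lambda>h. Re (g (w + c) * h))) (at (w + c))"
      using v E[OF that] unfolding cgrad_on_def by blast
    then have "((\<lambda>w. v (w + c)) has_derivative (\<lambda>h. Re (g (w + c) * h))) (at w)"
      by (rule has_derivative_compose[rotated]) (auto intro!: derivative_eq_intros)
    from has_derivative_mult_right[OF this, of a] show ?thesis by (simp add: mult.assoc)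
  qed
  ultimately show ?thesis unfolding cgrad_on_def by (auto intro!: holomorphic_intros)
qed

lemma cgrad_on_lipschitz:
  assumes "convex E" "cgrad_on v g E" "\<And>z. z \<in> E \<Longrightarrow> norm (g z) \<le> L" "x \<in> E" "y \<in> E"
  shows "\<bar>v x - v y\<bar> \<le> L * norm (x - y)"
proof -
  have "norm (v x - v y) \<le> L * norm (x - y)"
  proof (rule differentiable_bound[OF assms(1) _ _ assms(4,5)])
    fix z assume z: "z \<in> E"
    show "(v has_derivative (\<lambda>h. Re (g z * h))) (at z within E)"
      using assms(2) z has_derivative_at_withinI unfolding cgrad_on_def by blast
    show "onorm (\<lambda>h. Re (g z * h)) \<le> L"
    proof (rule onorm_le)
      fix h
      have "norm (Re (g z * h)) \<le> norm (g z) * norm h" using abs_Re_le_cmod[of "g z * h"] by (simp add: norm_mult)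
      also have "\<dots> \<le> L * norm h" using assms(3)[OF z] by (intro mult_right_mono) auto
      finally show "norm (Re (g z * h)) \<le> L * norm h" .
    qed
  qed
  then show ?thesis by simp
qed

locale near_strip_flow = log_flow +
  fixes A B :: real
  assumes lim: "(\<tau>0 \<longlongrightarrow> A) at_top" "(\<tau>1 \<longlongrightarrow> B) at_top"
    and AB: "A < B" "\<And>n::nat. B - A \<noteq> real n * pi"
begin

text \<open>Convex open sets that exhaust the exact strip. The margin
  \<open>1 / real (Suc i)\<close> leaves room for the boundary curves, which only converge to the
  edges, and the bound on \<open>Re w\<close> makes both the shift into the far region and the bound
  \<open>M * exp (Re w)\<close> uniform.\<close>

definition core :: "nat \<Rightarrow> complex set" where
  "core i = {w. \<bar>Re w\<bar> < real i \<and> A + 1 / real (Suc i) < Im w \<and> Im w < B - 1 / real (Suc i)}"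

lemma core_eq: "core i = {w. - real i < Re w} \<inter> {w. Re w < real i} \<inter>
    {w. A + 1 / real (Suc i) < Im w} \<inter> {w. Im w < B - 1 / real (Suc i)}"
  by (auto simp: core_def)

lemma open_core: "open (core i)"
  unfolding core_eq
  by (intro open_Int open_halfspace_Re_lt open_halfspace_Re_gt open_halfspace_Im_lt open_halfspace_Im_gt)

lemma convex_core: "convex (core i)"
  unfolding core_eq
  by (intro convex_Int convex_halfspace_Re_lt convex_halfspace_Re_gt convex_halfspace_Im_lt convex_halfspace_Im_gt)

lemma core_mono: "i \<le> j \<Longrightarrow> core i \<subseteq> core j"
proof
  fix w assume ij: "i \<le> j" and w: "w \<in> core i"
  have "1 / real (Suc j) \<le> 1 / real (Suc i)" using ij by (simp add: frac_le)
  then show "w \<in> core j" using w ij unfolding core_def by auto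
qed

lemma UN_core: "(\<Union>i. core i) = {w. A < Im w \<and> Im w < B}"
proof (intro equalityI subsetI)
  fix w assume "w \<in> (\<Union>i. core i)"
  then obtain i where "A + 1 / real (Suc i) < Im w" "Im w < B - 1 / real (Suc i)"
    by (auto simp: core_def)
  moreover have "0 < 1 / real (Suc i)" by simp
  ultimately show "w \<in> {w. A < Im w \<and> Im w < B}" by (simp only: mem_Collect_eq) linarith
next
  fix w assume "w \<in> {w. A < Im w \<and> Im w < B}"
  then have w: "A < Im w" "Im w < B" by auto
  obtain n1 where n1: "1 / real (Suc n1) < min (Im w - A) (B - Im w)"
    using w reals_Archimedean[of "min (Im w - A) (B - Im w)"] by (auto simp: inverse_eq_divide)
  obtain n2 where n2: "\<bar>Re w\<bar> < real n2" using reals_Archimedean2 by blast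
  have "1 / real (Suc (max n1 n2)) \<le> 1 / real (Suc n1)" by (simp add: frac_le)
  then have "w \<in> core (max n1 n2)" using n1 n2 by (auto simp: core_def)
  then show "w \<in> (\<Union>i. core i)" by blast
qed

lemma eventually_translate_core:
  assumes \<sigma>: "filterlim \<sigma> at_top sequentially"
  shows "\<forall>\<^sub>F n in sequentially. \<forall>w\<in>core i. w + of_real (\<sigma> n) \<in> D"
proof -
  let ?d = "1 / real (Suc i)"
  have "\<forall>\<^sub>F s in at_top. \<tau>0 s < A + ?d \<and> B - ?d < \<tau>1 s \<and> S0 < s"
    using order_tendstoD(2)[OF lim(1), of "A + ?d"] order_tendstoD(1)[OF lim(2), of "B - ?d"]
    by (intro eventually_conj eventually_gt_at_top) auto
  then obtain N where N: "\<And>s. N \<le> s \<Longrightarrow> \<tau>0 s < A + ?d \<and> B - ?d < \<tau>1 s \<and> S0 < s"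
    unfolding eventually_at_top_linorder by blast
  have "\<forall>\<^sub>F n in sequentially. N + real i \<le> \<sigma> n" using \<sigma> by (simp add: filterlim_at_top)
  then show ?thesis
  proof eventually_elim
    case (elim n)
    show ?case
    proof
      fix w assume w: "w \<in> core i"
      then have "N \<le> Re w + \<sigma> n" using elim by (auto simp: core_def)
      from N[OF this] show "w + of_real (\<sigma> n) \<in> D"
        using w by (auto simp: core_def log_domain_def)
    qed
  qed
qed

text \<open>The danger in the compactness argument is that the bad points drift to the boundary and
  the limit vanishes. The two distance bounds prevent it: a rescaled value above
  \<open>\<epsilon>\<close> forces a distance above \<open>\<epsilon> / M\<close> from either curve.
  Rigidity then makes the limit a nonzero constant, whereas the distance bound forces it to 0 as
  \<open>Re w\<close> tends to minus infinity.\<close>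

lemma stream_sublinear:
  assumes \<epsilon>: "0 < \<epsilon>"
  shows "\<exists>N. \<forall>w\<in>D. N < Re w \<longrightarrow> \<bar>u w\<bar> \<le> \<epsilon> * exp (Re w)"
proof (rule ccontr)
  assume "\<not> ?thesis"
  then have "\<forall>n::nat. \<exists>w. w \<in> D \<and> real n < Re w \<and> \<epsilon> * exp (Re w) < \<bar>u w\<bar>"
    by (meson not_less)
  then obtain x where x: "\<And>n. x n \<in> D" "\<And>n::nat. real n < Re (x n)"
    "\<And>n. \<epsilon> * exp (Re (x n)) < \<bar>u (x n)\<bar>"
    by metis
  define v where "v n = exp (- Re (x n)) * u (x n)" for n
  have v_gt: "\<epsilon> < \<bar>v n\<bar>" for n
  proof -
    have "exp (- Re (x n)) * (\<epsilon> * exp (Re (x n))) < exp (- Re (x n)) * \<bar>u (x n)\<bar>"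
      using x(3) by (intro mult_strict_left_mono) auto
    then show ?thesis by (simp add: v_def abs_mult exp_minus field_simps)
  qed
  have v_le: "\<bar>v n\<bar> \<le> M * (Im (x n) - \<tau>0 (Re (x n)))" "\<bar>v n\<bar> \<le> M * (\<tau>1 (Re (x n)) - Im (x n))" for n
    using lower_distance_bound[OF x(1)[of n]] upper_distance_bound[OF x(1)[of n]]
    by (simp_all add: v_def abs_mult exp_minus field_simps)
  have xD: "\<tau>0 (Re (x n)) < Im (x n)" "Im (x n) < \<tau>1 (Re (x n))" for n
    using x(1)[of n] by (auto simp: log_domain_def)
  have M: "0 < M"
  proof -
    have "0 < M * (Im (x 0) - \<tau>0 (Re (x 0)))" using v_gt[of 0] v_le(1)[of 0] \<epsilon> by linarith
    then show ?thesis using xD(1)[of 0] by (simp add: zero_less_mult_iff)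
  qed
  have \<sigma>: "filterlim (\<lambda>n. Re (x n)) at_top sequentially"
    by (rule filterlim_at_top_mono[OF filterlim_real_sequentially])
       (use x(2) in \<open>auto intro!: always_eventually less_imp_le\<close>)
  have T: "(\<lambda>n. \<tau>0 (Re (x n))) \<longlonglongrightarrow> A" "(\<lambda>n. \<tau>1 (Re (x n))) \<longlonglongrightarrow> B"
    using filterlim_compose[OF lim(1) \<sigma>] filterlim_compose[OF lim(2) \<sigma>] by auto
  \<comment> \<open>One subsequence for both the heights and the rescaled values.\<close>
  define X where "X n = Complex (Im (x n)) (v n)" for n
  have "bounded (range X)"
  proof -
    obtain K0 K1 where K: "\<And>n. \<bar>\<tau>0 (Re (x n))\<bar> \<le> K0" "\<And>n. \<bar>\<tau>1 (Re (x n))\<bar> \<le> K1"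
      using T[THEN convergentI, THEN convergent_imp_Bseq] unfolding Bseq_def by auto
    have "norm (X n) \<le> (K0 + K1) + M * (K0 + K1)" for n
    proof -
      have "\<bar>Im (x n)\<bar> \<le> K0 + K1" using K(1)[of n] K(2)[of n] xD[of n] by linarith
      moreover have "\<tau>1 (Re (x n)) - Im (x n) \<le> K0 + K1" using K(1)[of n] K(2)[of n] xD[of n] by linarith
      then have "M * (\<tau>1 (Re (x n)) - Im (x n)) \<le> M * (K0 + K1)" using M by (intro mult_left_mono) auto
      then have "\<bar>v n\<bar> \<le> M * (K0 + K1)" using v_le(2)[of n] by linarith
      ultimately show ?thesis using cmod_le[of "X n"] by (simp add: X_def)
    qed
    then show ?thesis by (auto simp: bounded_iff)
  qed
  then obtain L r where r: "strict_mono (r :: nat \<Rightarrow> nat)" "(X \<circ> r) \<longlonglongrightarrow> L"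
    using bounded_imp_convergent_subsequence by blast
  define \<sigma>' where "\<sigma>' n = Re (x (r n))" for n
  have \<sigma>': "filterlim \<sigma>' at_top sequentially"
    unfolding \<sigma>'_def by (rule filterlim_compose[OF \<sigma> filterlim_subseq[OF r(1)]])
  \<comment> \<open>Shifting by \<open>\<sigma>' n\<close> multiplies the gradient bound by
    \<open>exp (\<sigma>' n)\<close>, and the prefactor takes this out again.\<close>
  define \<Phi> where "\<Phi> n w = of_real (exp (- \<sigma>' n)) * g (w + of_real (\<sigma>' n))" for n w
  define \<Psi> where "\<Psi> n w = exp (- \<sigma>' n) * u (w + of_real (\<sigma>' n))" for n w
  have grad: "\<forall>\<^sub>F n in sequentially. cgrad_on (\<Psi> n) (\<Phi> n) (core i)" for i
    using eventually_translate_core[OF \<sigma>', of i]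
    by eventually_elim (auto simp: \<Psi>_def[abs_def] \<Phi>_def[abs_def] intro!: cgrad_on_translate[OF cgrad])
  have \<Phi>_bd: "\<forall>\<^sub>F n in sequentially. \<forall>w\<in>core i. norm (\<Phi> n w) \<le> M * exp (Re w)" for i
    using eventually_translate_core[OF \<sigma>', of i]
  proof eventually_elim
    case (elim n)
    show ?case
    proof
      fix w assume "w \<in> core i"
      then have "norm (g (w + of_real (\<sigma>' n))) \<le> M * exp (Re w + \<sigma>' n)"
        using gradient_bound[of "w + of_real (\<sigma>' n)"] elim by simp
      then show "norm (\<Phi> n w) \<le> M * exp (Re w)"
        by (simp add: \<Phi>_def norm_mult norm_divide exp_add exp_minus field_simps)
    qed
  qed
  have hol: "\<forall>\<^sub>F n in sequentially. \<Phi> n holomorphic_on core i" for i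
    using grad[of i] by eventually_elim (simp add: cgrad_on_def)
  have bdd: "\<exists>C. \<forall>\<^sub>F n in sequentially. \<forall>w\<in>core i. norm (\<Phi> n w) \<le> C" for i
  proof
    show "\<forall>\<^sub>F n in sequentially. \<forall>w\<in>core i. norm (\<Phi> n w) \<le> M * exp (real i)"
      using \<Phi>_bd[of i]
    proof eventually_elim
      case (elim n)
      show ?case
      proof
        fix w assume w: "w \<in> core i"
        have "M * exp (Re w) \<le> M * exp (real i)" using w M by (auto simp: core_def)
        then show "norm (\<Phi> n w) \<le> M * exp (real i)" using elim w by force
      qed
    qed
  qed
  let ?S = "{w. A < Im w \<and> Im w < B}"
  obtain k h where k: "strict_mono (k :: nat \<Rightarrow> nat)" and h: "h holomorphic_on ?S"
    and ul: "\<And>K. compact K \<Longrightarrow> K \<subseteq> ?S \<Longrightarrow> uniform_limit K (\<lambda>n. \<Phi> (k n)) h sequentially"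
    using Montel_exhaustion[of core \<Phi>, OF open_core core_mono hol bdd] unfolding UN_core by blast
  note ev_k = eventually_compose_filterlim[OF _ filterlim_subseq[OF k]]
  have X': "(\<lambda>n. Im (x (r (k n)))) \<longlonglongrightarrow> Re L" "(\<lambda>n. v (r (k n))) \<longlonglongrightarrow> Im L"
  proof -
    have "(\<lambda>n. X (r (k n))) \<longlonglongrightarrow> L"
      using LIMSEQ_subseq_LIMSEQ[OF r(2) k] by (simp add: o_def)
    from tendsto_Re[OF this] tendsto_Im[OF this]
    show "(\<lambda>n. Im (x (r (k n)))) \<longlonglongrightarrow> Re L" "(\<lambda>n. v (r (k n))) \<longlonglongrightarrow> Im L"
      by (simp_all add: X_def)
  qed
  have rk: "filterlim (\<lambda>n. r (k n)) sequentially sequentially"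
    by (rule filterlim_compose[OF filterlim_subseq[OF r(1)] filterlim_subseq[OF k]])
  note T' = T[THEN filterlim_compose, OF rk]
  have L_gt: "\<epsilon> \<le> \<bar>Im L\<bar>"
    by (rule LIMSEQ_le_const[OF tendsto_rabs[OF X'(2)]]) (use v_gt in \<open>auto intro: less_imp_le\<close>)
  \<comment> \<open>Passing to the limit in \<open>v_le\<close> keeps the limiting height
    \<open>Re L\<close> strictly inside the strip.\<close>
  have "\<epsilon> \<le> M * (Re L - A)"
    by (rule LIMSEQ_le_const[OF tendsto_mult[OF tendsto_const tendsto_diff[OF X'(1) T'(1)]]])
       (intro exI[of _ 0] allI impI order_trans[OF less_imp_le[OF v_gt] v_le(1)])
  moreover have "\<epsilon> \<le> M * (B - Re L)"
    by (rule LIMSEQ_le_const[OF tendsto_mult[OF tendsto_const tendsto_diff[OF T'(2) X'(1)]]])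
       (intro exI[of _ 0] allI impI order_trans[OF less_imp_le[OF v_gt] v_le(2)])
  ultimately have L: "A < Re L" "Re L < B"
    using \<epsilon> M by (smt (verit) mult_nonneg_nonpos)+
  define p where "p = Complex 0 (Re L)"
  have pS: "p \<in> ?S" using L by (simp add: p_def)
  have cS: "convex ?S" "open ?S"
  proof -
    have "?S = {w. A < Im w} \<inter> {w. Im w < B}" by auto
    then show "convex ?S" "open ?S"
      by (simp_all add: convex_Int convex_halfspace_Im_gt convex_halfspace_Im_lt
          open_Int open_halfspace_Im_gt open_halfspace_Im_lt)
  qed
  obtain F0 where F0: "\<And>w. w \<in> ?S \<Longrightarrow> (F0 has_field_derivative h w) (at w within ?S)"
    using holomorphic_convex_primitive'[OF cS h] by blast
  \<comment> \<open>Normalised so that the real part at \<open>p\<close> is \<open>Im L\<close>, the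
    limit of the rescaled values at the bad points.\<close>
  define F where "F w = F0 w - F0 p + of_real (Im L)" for w
  have F: "(F has_field_derivative h w) (at w)" if "w \<in> ?S" for w
  proof -
    have "(F0 has_field_derivative h w) (at w)" using F0[OF that] at_within_open[OF that cS(2)] by simp
    then show ?thesis unfolding F_def by (auto intro!: derivative_eq_intros)
  qed
  have Fp: "Re (F p) = Im L" by (simp add: F_def)
  have in_core: "\<exists>i. w \<in> core i \<and> p \<in> core i" if w: "w \<in> ?S" for w
  proof -
    have "w \<in> (\<Union>i. core i)" "p \<in> (\<Union>i. core i)" using w pS unfolding UN_core by blast+
    then obtain i j where "w \<in> core i" "p \<in> core j" by blast
    then have "w \<in> core (max i j)" "p \<in> core (max i j)"
      using core_mono[of i "max i j"] core_mono[of j "max i j"] by auto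
    then show ?thesis by blast
  qed
  \<comment> \<open>The known values are those at the moving points \<open>y n\<close>; the gradient
    bound on a core makes the functions equally Lipschitz, which carries the limit over to
    \<open>p\<close>.\<close>
  have lim_p: "(\<lambda>n. \<Psi> (k n) p) \<longlonglongrightarrow> Im L"
  proof -
    obtain i where i: "p \<in> core i" using in_core[OF pS] by blast
    define y where "y n = Complex 0 (Im (x (r (k n))))" for n
    have y: "y \<longlonglongrightarrow> p" unfolding y_def p_def by (intro tendsto_Complex tendsto_const X')
    have \<Psi>y: "\<Psi> (k n) (y n) = v (r (k n))" for n
    proof -
      have "y n + of_real (\<sigma>' (k n)) = x (r (k n))" by (simp add: y_def \<sigma>'_def complex_eq_iff)
      then show ?thesis by (simp add: \<Psi>_def v_def \<sigma>'_def)
    qed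
    have yi: "\<forall>\<^sub>F n in sequentially. y n \<in> core i" using y open_core i by (rule topological_tendstoD)
    have near: "\<forall>\<^sub>F n in sequentially. norm (\<Psi> (k n) p - v (r (k n))) \<le> (M * exp (real i)) * norm (p - y n)"
      using ev_k[OF grad[of i]] ev_k[OF \<Phi>_bd[of i]] yi
    proof eventually_elim
      case (elim n)
      have "norm (\<Phi> (k n) z) \<le> M * exp (real i)" if "z \<in> core i" for z
      proof -
        have "M * exp (Re z) \<le> M * exp (real i)" using that M by (auto simp: core_def)
        then show ?thesis using elim(2) that by force
      qed
      from cgrad_on_lipschitz[OF convex_core elim(1) this i elim(3)]
      show ?case by (simp add: \<Psi>y)
    qed
    have "(\<lambda>n. (M * exp (real i)) * norm (p - y n)) \<longlonglongrightarrow> (M * exp (real i)) * norm (p - p)"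
      by (intro tendsto_intros y)
    then have "(\<lambda>n. (M * exp (real i)) * norm (p - y n)) \<longlonglongrightarrow> 0" by simp
    with near have "(\<lambda>n. \<Psi> (k n) p - v (r (k n))) \<longlonglongrightarrow> 0" by (rule Lim_null_comparison)
    from tendsto_add[OF this X'(2)] show ?thesis by simp
  qed
  \<comment> \<open>The gradients converge uniformly on the segment from \<open>p\<close> to
    \<open>w\<close>, so the difference of the functions changes by a vanishing amount along
    it.\<close>
  have lim_F: "(\<lambda>n. \<Psi> (k n) w) \<longlonglongrightarrow> Re (F w)" if w: "w \<in> ?S" for w
  proof -
    obtain i where i: "w \<in> core i" "p \<in> core i" using in_core[OF w] by blast
    let ?K = "closed_segment p w"
    have Ki: "?K \<subseteq> core i" using i convex_core by (simp add: closed_segment_subset)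
    then have KS: "?K \<subseteq> ?S" unfolding UN_core[symmetric] by blast
    have hF: "cgrad_on (\<lambda>w. Re (F w)) h ?S"
      using h F unfolding cgrad_on_def has_field_derivative_def
      by (auto intro!: derivative_eq_intros)
    have "(\<lambda>n. (\<Psi> (k n) w - Re (F w)) - (\<Psi> (k n) p - Re (F p))) \<longlonglongrightarrow> 0"
    proof (rule tendstoI)
      fix e :: real assume e: "0 < e"
      define e' where "e' = e / (norm (w - p) + 1)"
      have e': "0 < e'" "e' * norm (w - p) < e"
        using e by (auto simp: e'_def field_simps add_pos_nonneg)
      have "\<forall>\<^sub>F n in sequentially. \<forall>z\<in>?K. dist (\<Phi> (k n) z) (h z) < e'"
        using ul[OF compact_segment KS] e'(1) by (rule uniform_limitD)
      then show "\<forall>\<^sub>F n in sequentially. dist ((\<Psi> (k n) w - Re (F w)) - (\<Psi> (k n) p - Re (F p))) 0 < e"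
        using ev_k[OF grad[of i]]
      proof eventually_elim
        case (elim n)
        have "cgrad_on (\<lambda>z. \<Psi> (k n) z - Re (F z)) (\<lambda>z. \<Phi> (k n) z - h z) ?K"
          using cgrad_on_subset[OF elim(2) Ki] cgrad_on_subset[OF hF KS] by (rule cgrad_on_diff)
        then have "\<bar>(\<Psi> (k n) w - Re (F w)) - (\<Psi> (k n) p - Re (F p))\<bar> \<le> e' * norm (w - p)"
          by (rule cgrad_on_lipschitz[OF convex_closed_segment])
             (use elim(1) in \<open>auto simp: dist_norm less_imp_le\<close>)
        then show ?case using e'(2) by (simp add: dist_norm)
      qed
    qed
    from tendsto_add[OF this tendsto_add[OF lim_p tendsto_const[of "Re (F w) - Re (F p)"]]]
    show ?thesis by (simp add: Fp)
  qed
  have ev_in: "\<forall>\<^sub>F n in sequentially. w + of_real (\<sigma>' (k n)) \<in> D" if "w \<in> ?S" for w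
  proof -
    obtain i where "w \<in> core i" using in_core[OF \<open>w \<in> ?S\<close>] by blast
    then show ?thesis using ev_k[OF eventually_translate_core[OF \<sigma>', of i]] by (auto elim: eventually_mono)
  qed
  have \<rho>: "filterlim (\<lambda>n. Re w + \<sigma>' (k n)) at_top sequentially" for w
    by (rule filterlim_tendsto_add_at_top[OF tendsto_const filterlim_compose[OF \<sigma>' filterlim_subseq[OF k]]])
  have bdF: "\<bar>Re (F w)\<bar> \<le> M * exp (Re w) * (Im w - A)" "\<bar>Re (F w)\<bar> \<le> M * exp (Re w) * (B - Im w)"
    if w: "A < Im w" "Im w < B" for w
  proof -
    have wS: "w \<in> ?S" using w by simp
    have l: "(\<lambda>n. \<bar>\<Psi> (k n) w\<bar>) \<longlonglongrightarrow> \<bar>Re (F w)\<bar>" by (intro tendsto_intros lim_F wS)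
    show "\<bar>Re (F w)\<bar> \<le> M * exp (Re w) * (Im w - A)"
    proof (rule tendsto_le[OF sequentially_bot _ l])
      show "(\<lambda>n. M * exp (Re w) * (Im w - \<tau>0 (Re w + \<sigma>' (k n)))) \<longlonglongrightarrow> M * exp (Re w) * (Im w - A)"
        by (intro tendsto_intros filterlim_compose[OF lim(1) \<rho>])
      show "\<forall>\<^sub>F n in sequentially. \<bar>\<Psi> (k n) w\<bar> \<le> M * exp (Re w) * (Im w - \<tau>0 (Re w + \<sigma>' (k n)))"
        using ev_in[OF wS]
      proof eventually_elim
        case (elim n)
        show ?case using lower_distance_bound[OF elim]
          by (simp add: \<Psi>_def abs_mult exp_add exp_minus field_simps)
      qed
    qed
    show "\<bar>Re (F w)\<bar> \<le> M * exp (Re w) * (B - Im w)"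
    proof (rule tendsto_le[OF sequentially_bot _ l])
      show "(\<lambda>n. M * exp (Re w) * (\<tau>1 (Re w + \<sigma>' (k n)) - Im w)) \<longlonglongrightarrow> M * exp (Re w) * (B - Im w)"
        by (intro tendsto_intros filterlim_compose[OF lim(2) \<rho>])
      show "\<forall>\<^sub>F n in sequentially. \<bar>\<Psi> (k n) w\<bar> \<le> M * exp (Re w) * (\<tau>1 (Re w + \<sigma>' (k n)) - Im w)"
        using ev_in[OF wS]
      proof eventually_elim
        case (elim n)
        show ?case using upper_distance_bound[OF elim]
          by (simp add: \<Psi>_def abs_mult exp_add exp_minus field_simps)
      qed
    qed
  qed
  have bdh: "norm (h w) \<le> M * exp (Re w)" if w: "A < Im w" "Im w < B" for w
  proof -
    have wS: "w \<in> ?S" using w by simp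
    have "uniform_limit {w} (\<lambda>n. \<Phi> (k n)) h sequentially" using wS by (intro ul) auto
    then have l: "(\<lambda>n. norm (\<Phi> (k n) w)) \<longlonglongrightarrow> norm (h w)"
      by (intro tendsto_norm tendsto_uniform_limitI[where S = "{w}"]) auto
    obtain i where i: "w \<in> core i" using in_core[OF wS] by blast
    show ?thesis
      by (rule tendsto_upperbound[OF l _ sequentially_bot])
         (use ev_k[OF \<Phi>_bd[of i]] i in \<open>auto elim: eventually_mono\<close>)
  qed
  have h0: "h w = 0" if "w \<in> ?S" for w
    by (rule strip_rigidity[OF AB, of F h M]) (use F bdF bdh that in auto)
  have "\<exists>c. \<forall>w\<in>?S. F w = c"
    using has_field_derivative_zero_constant[OF cS(1), of F] F h0
    by (metis (no_types, lifting) has_field_derivative_at_within)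
  then have const: "Re (F w) = Im L" if "w \<in> ?S" for w using that pS Fp by metis
  \<comment> \<open>The real part is chosen so far to the left that the bound for
    \<open>Re (F q)\<close> equals \<open>\<epsilon> / 2\<close>.\<close>
  define q where "q = Complex (ln (\<epsilon> / (2 * M * (Re L - A)))) (Re L)"
  have pos: "0 < \<epsilon> / (2 * M * (Re L - A))" using \<epsilon> M L by simp
  have "\<bar>Im L\<bar> \<le> M * exp (Re q) * (Im q - A)" using bdF(1)[of q] const[of q] L by (simp add: q_def)
  also have "\<dots> = \<epsilon> / 2" using pos M L by (simp add: q_def field_simps)
  finally show False using L_gt \<epsilon> by simp
qed

end

section \<open>The boundary barrier\<close>

text \<open>
  Scale-one C2 smallness of the boundary curve; the constants are those that make the barrier
  below nonnegative on the domain.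
\<close>
definition almost_flat :: "(real \<Rightarrow> real) \<Rightarrow> real \<Rightarrow> bool" where
  "almost_flat \<tau> s \<longleftrightarrow>
     (\<exists>m. \<bar>m\<bar> \<le> 1/2 \<and> (\<forall>x. \<bar>x\<bar> \<le> 1 \<longrightarrow> \<bar>\<tau> (s + x) - \<tau> s - m * x\<bar> \<le> x\<^sup>2 / 10))"

lemma almost_flat_uminus: "almost_flat \<tau> s \<Longrightarrow> almost_flat (\<lambda>s. - \<tau> s) s"
  unfolding almost_flat_def
proof (elim exE conjE)
  fix m assume m: "\<bar>m\<bar> \<le> 1/2" "\<forall>x. \<bar>x\<bar> \<le> 1 \<longrightarrow> \<bar>\<tau> (s + x) - \<tau> s - m * x\<bar> \<le> x\<^sup>2 / 10"
  have "\<bar>- \<tau> (s + x) - - \<tau> s - - m * x\<bar> = \<bar>\<tau> (s + x) - \<tau> s - m * x\<bar>" for x by simp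
  then show "\<exists>m. \<bar>m\<bar> \<le> 1/2 \<and> (\<forall>x. \<bar>x\<bar> \<le> 1 \<longrightarrow> \<bar>- \<tau> (s + x) - - \<tau> s - m * x\<bar> \<le> x\<^sup>2 / 10)"
    using m by (intro exI[of _ "- m"]) simp
qed

text \<open>The slope contributes 1/2 and the deviation 1/10, together less than the stated constant
  1, with which a boundary curve moves vertically no more than the point moves horizontally.\<close>

lemma almost_flat_lipschitz:
  assumes "almost_flat \<tau> s" "\<bar>x\<bar> \<le> 1"
  shows "\<bar>\<tau> (s + x) - \<tau> s\<bar> \<le> \<bar>x\<bar>"
proof -
  obtain m where m: "\<bar>m\<bar> \<le> 1/2" "\<bar>\<tau> (s + x) - \<tau> s - m * x\<bar> \<le> x\<^sup>2 / 10"
    using assms unfolding almost_flat_def by blast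
  have "\<bar>m * x\<bar> \<le> 1/2 * \<bar>x\<bar>" unfolding abs_mult using m(1) by (intro mult_right_mono) auto
  moreover have "x\<^sup>2 \<le> \<bar>x\<bar>"
    using mult_right_mono[OF assms(2), of "\<bar>x\<bar>"] by (simp add: power2_eq_square flip: abs_mult)
  ultimately show ?thesis using m(2) by linarith
qed

text \<open>
  With P the height above the tangent line of the boundary curve, the expression is the harmonic
  polynomial \<open>4 (Y - m x) + x\<^sup>2 - Y\<^sup>2\<close>, \<open>Y = P + m x\<close>, that serves as the barrier in \<open>stream_barrier\<close>.
\<close>
lemma barrier_bounds:
  fixes x P m :: real
  assumes "\<bar>m\<bar> \<le> 1/2" "\<bar>x\<bar> \<le> 1" "- (x\<^sup>2 / 10) \<le> P" "P \<le> 1"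
  shows "0 \<le> 4 * P + x\<^sup>2 - (P + m * x)\<^sup>2"
    and "\<bar>x\<bar> = 1 \<or> P = 1 \<Longrightarrow> 1/20 < 4 * P + x\<^sup>2 - (P + m * x)\<^sup>2"
proof -
  have m2: "m\<^sup>2 \<le> 1/4" using power_mono[OF assms(1), of 2] by (simp add: power2_eq_square)
  have x2: "x\<^sup>2 \<le> 1" using power_mono[OF assms(2), of 2] by simp
  have "(P + m * x)\<^sup>2 \<le> 2 * P\<^sup>2 + 2 * (m\<^sup>2 * x\<^sup>2)"
    using zero_le_power2[of "P - m * x"] by (simp add: power2_eq_square algebra_simps)
  moreover have "m\<^sup>2 * x\<^sup>2 \<le> 1/4 * x\<^sup>2" using m2 by (intro mult_right_mono) auto
  ultimately have *: "4 * P - 2 * P\<^sup>2 + x\<^sup>2 / 2 \<le> 4 * P + x\<^sup>2 - (P + m * x)\<^sup>2" by linarith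
  \<comment> \<open>For negative P the lower bound \<open>- (x\<^sup>2 / 10)\<close> costs 4/10 and
    2/100 of \<open>x\<^sup>2\<close>; the remainder 1/2 - 4/10 - 2/100 = 2/25 exceeds 1/20, the
    value claimed at \<open>\<bar>x\<bar> = 1\<close>.\<close>
  have key: "2/25 * x\<^sup>2 \<le> 4 * P - 2 * P\<^sup>2 + x\<^sup>2 / 2 \<and> (0 \<le> P \<longrightarrow> 2 * P \<le> 4 * P - 2 * P\<^sup>2 + x\<^sup>2 / 2)"
  proof (cases "0 \<le> P")
    case True
    then have "P\<^sup>2 \<le> P" using mult_left_mono[OF assms(4) True] by (simp add: power2_eq_square)
    then show ?thesis using True zero_le_power2[of x] by linarith
  next
    case False
    have "\<bar>P\<bar> \<le> x\<^sup>2 / 10" using False assms(3) by linarith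
    from power_mono[OF this, of 2] have "P\<^sup>2 \<le> x\<^sup>2 * x\<^sup>2 / 100" by (simp add: power2_eq_square)
    moreover have "x\<^sup>2 * x\<^sup>2 \<le> x\<^sup>2 * 1" using x2 by (intro mult_left_mono) auto
    ultimately show ?thesis using False assms(3) by linarith
  qed
  show "0 \<le> 4 * P + x\<^sup>2 - (P + m * x)\<^sup>2" using * key zero_le_power2[of x] by linarith
  show "1/20 < 4 * P + x\<^sup>2 - (P + m * x)\<^sup>2" if "\<bar>x\<bar> = 1 \<or> P = 1"
    using that
  proof
    assume "\<bar>x\<bar> = 1"
    then have "x\<^sup>2 = 1" by (metis power2_abs one_power2)
    then show ?thesis using * key by linarith
  next
    assume "P = 1"
    then have "2 \<le> 4 * P - 2 * P\<^sup>2 + x\<^sup>2 / 2" using key by simp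
    then show ?thesis using * by linarith
  qed
qed

context log_flow
begin

text \<open>Comparison of u and - u with \<open>20 * K * Re (H w)\<close> on the part of the domain
  near the boundary point \<open>c\<close>. On the artificial sides \<open>Re H\<close> exceeds
  1/20, so the barrier exceeds K there. On the true boundary, which may include a piece of the upper
  curve, u tends to 0 and \<open>Re H\<close> is nonnegative. Vertically above \<open>c\<close> the
  barrier grows at most like 4 times the height, whence 80 = 20 * 4.\<close>

lemma stream_barrier:
  assumes s: "S0 + 1 < s" and flat: "almost_flat \<tau>0 s"
    and K: "0 < K" "\<And>w. w \<in> D \<Longrightarrow> \<bar>Re w - s\<bar> \<le> 1 \<Longrightarrow> \<bar>u w\<bar> \<le> K"
    and t: "Complex s t \<in> D"
  shows "\<bar>u (Complex s t)\<bar> \<le> 80 * K * (t - \<tau>0 s)"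
proof (cases "t - \<tau>0 s < 1")
  case False
  have "\<bar>u (Complex s t)\<bar> \<le> K" using K(2)[OF t] by simp
  also have "\<dots> \<le> 80 * K * (t - \<tau>0 s)" using K(1) False mult_left_mono[of 1 "t - \<tau>0 s" "80 * K"] by simp
  finally show ?thesis .
next
  case True
  obtain m where m: "\<bar>m\<bar> \<le> 1/2" "\<And>x. \<bar>x\<bar> \<le> 1 \<Longrightarrow> \<bar>\<tau>0 (s + x) - \<tau>0 s - m * x\<bar> \<le> x\<^sup>2 / 10"
    using flat unfolding almost_flat_def by blast
  define c where "c = Complex s (\<tau>0 s)"
  define P where "P w = Im w - \<tau>0 s - m * (Re w - s)" for w
  \<comment> \<open>A holomorphic polynomial whose real part is the barrier, which makes the barrier
    accessible to \<open>cgrad_on_maximum_principle\<close>.\<close>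
  define H where "H w = (w - c)\<^sup>2 - 4 * \<i> * (w - c) - 4 * of_real m * (w - c)" for w
  have Re_H: "Re (H w) = 4 * P w + (Re w - s)\<^sup>2 - (P w + m * (Re w - s))\<^sup>2" for w
    by (simp add: H_def P_def c_def power2_eq_square algebra_simps)
  have contP: "continuous_on UNIV P" unfolding P_def by (intro continuous_intros)
  have "continuous_on UNIV (\<lambda>w. Re (H w))" unfolding H_def by (intro continuous_intros)
  then have contH: "isCont (\<lambda>w. Re (H w)) w" for w by (simp add: continuous_on_eq_continuous_at)
  define E where "E = D \<inter> {w. \<bar>Re w - s\<bar> < 1 \<and> P w < 1}"
  have E_eq: "E = D \<inter> {w. Re w < s + 1} \<inter> {w. s - 1 < Re w} \<inter> {w. P w < 1}"
    by (auto simp: E_def)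
  have openE: "open E" unfolding E_eq
    by (intro open_Int open_D open_halfspace_Re_lt open_halfspace_Re_gt open_Collect_less contP continuous_intros)
  have P_ge: "- ((Re w - s)\<^sup>2 / 10) \<le> P w" if "\<bar>Re w - s\<bar> \<le> 1" "\<tau>0 (Re w) \<le> Im w" for w
  proof -
    have "\<bar>\<tau>0 (Re w) - \<tau>0 s - m * (Re w - s)\<bar> \<le> (Re w - s)\<^sup>2 / 10" using m(2)[OF that(1)] by simp
    then show ?thesis using that(2) unfolding P_def by linarith
  qed
  have boundedE: "bounded E"
  proof -
    have "norm w \<le> \<bar>s\<bar> + 1 + (\<bar>\<tau>0 s\<bar> + 3)" if w: "w \<in> E" for w
    proof -
      have w: "\<bar>Re w - s\<bar> < 1" "P w < 1" "\<tau>0 (Re w) < Im w" using w by (auto simp: E_def log_domain_def)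
      have "(Re w - s)\<^sup>2 \<le> 1" using power_mono[of "\<bar>Re w - s\<bar>" 1 2] w(1) by simp
      then have "- 1 \<le> P w" using P_ge[of w] w by linarith
      moreover have "\<bar>m * (Re w - s)\<bar> \<le> 1 * 1" unfolding abs_mult using m(1) w(1) by (intro mult_mono) auto
      ultimately have "\<bar>Im w\<bar> \<le> \<bar>\<tau>0 s\<bar> + 3" using w(2) unfolding P_def by linarith
      moreover have "\<bar>Re w\<bar> \<le> \<bar>s\<bar> + 1" using w(1) by linarith
      ultimately show ?thesis using cmod_le[of w] by linarith
    qed
    then show ?thesis by (auto simp: bounded_iff)
  qed
  have bound: "\<sigma> * u w \<le> 20 * K * Re (H w)" if \<sigma>: "\<bar>\<sigma>\<bar> = 1" and w: "w \<in> E" for \<sigma> w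
  proof -
    have "\<sigma> * u w - 20 * K * Re (H w) \<le> 0"
    proof (rule cgrad_on_maximum_principle[OF openE boundedE _ _ w])
      have "cgrad_on (\<lambda>w. \<sigma> * u (w + 0)) (\<lambda>w. of_real \<sigma> * g (w + 0)) E"
        by (rule cgrad_on_translate[OF cgrad]) (auto simp: E_def)
      then have "cgrad_on (\<lambda>w. \<sigma> * u w) (\<lambda>w. of_real \<sigma> * g w) E" by simp
      moreover have "cgrad_on (\<lambda>w. Re (of_real (20 * K) * H w)) (deriv (\<lambda>w. of_real (20 * K) * H w)) E"
        unfolding H_def by (intro cgrad_on_Re openE holomorphic_intros)
      then have "cgrad_on (\<lambda>w. 20 * K * Re (H w)) (deriv (\<lambda>w. of_real (20 * K) * H w)) E" by simp
      ultimately show "cgrad_on (\<lambda>w. \<sigma> * u w - 20 * K * Re (H w))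
          (\<lambda>w. of_real \<sigma> * g w - deriv (\<lambda>w. of_real (20 * K) * H w) w) E"
        by (rule cgrad_on_diff)
    next
      fix b \<eta> assume b: "b \<in> frontier E" and \<eta>: "(0::real) < \<eta>"
      have bE: "b \<in> closure E" "b \<notin> E" using b openE by (auto simp: frontier_def interior_open)
      obtain y where y: "\<And>n. y n \<in> E" "y \<longlonglongrightarrow> b" using bE(1) by (auto simp: closure_sequential)
      have yE: "\<bar>Re (y n) - s\<bar> < 1" "P (y n) < 1" "\<tau>0 (Re (y n)) < Im (y n)" "Im (y n) < \<tau>1 (Re (y n))" for n
        using y(1)[of n] by (auto simp: E_def log_domain_def)
      have "(\<lambda>n. \<bar>Re (y n) - s\<bar>) \<longlonglongrightarrow> \<bar>Re b - s\<bar>" by (intro tendsto_intros y)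
      then have Re_b: "\<bar>Re b - s\<bar> \<le> 1"
        by (rule LIMSEQ_le_const2) (use yE(1) in \<open>auto intro: less_imp_le\<close>)
      then have b_S0: "S0 < Re b" using s by linarith
      have "(\<lambda>n. P (y n)) \<longlonglongrightarrow> P b" unfolding P_def by (intro tendsto_intros y)
      then have P_b: "P b \<le> 1"
        by (rule LIMSEQ_le_const2) (use yE(2) in \<open>auto intro: less_imp_le\<close>)
      have \<tau>_lim: "(\<lambda>n. \<tau> (Re (y n))) \<longlonglongrightarrow> \<tau> (Re b)" if "continuous_on {S0<..} \<tau>" for \<tau>
      proof -
        have "isCont \<tau> (Re b)" using that b_S0 by (simp add: continuous_on_eq_continuous_at)
        then show ?thesis by (rule isCont_tendsto_compose) (intro tendsto_intros y)
      qed
      have \<tau>_b: "\<tau>0 (Re b) \<le> Im b" "Im b \<le> \<tau>1 (Re b)"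
        by (rule LIMSEQ_le[OF \<tau>_lim[OF cont(1)] tendsto_Im[OF y(2)]];
              use yE(3) in \<open>auto intro: less_imp_le\<close>)
           (rule LIMSEQ_le[OF tendsto_Im[OF y(2)] \<tau>_lim[OF cont(2)]];
              use yE(4) in \<open>auto intro: less_imp_le\<close>)
      note bb = barrier_bounds[OF m(1) Re_b P_ge[OF Re_b \<tau>_b(1)] P_b, folded Re_H]
      have tH: "((\<lambda>w. 20 * K * Re (H w)) \<longlongrightarrow> 20 * K * Re (H b)) (at b within E)"
        using contH[of b] continuous_at_imp_continuous_at_within[of b "\<lambda>w. Re (H w)" E]
        by (intro tendsto_mult_left) (simp add: continuous_within)
      show "\<forall>\<^sub>F w in at b within E. \<sigma> * u w - 20 * K * Re (H w) < \<eta>"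
      \<comment> \<open>A frontier point of \<open>E\<close> inside \<open>D\<close> lies on an
        artificial side; any other lies on one of the boundary curves.\<close>
      proof (cases "b \<in> D")
        case True
        then have "\<bar>Re b - s\<bar> = 1 \<or> P b = 1" using bE(2) Re_b P_b by (auto simp: E_def)
        from bb(2)[OF this] have "K < 20 * K * Re (H b)" using K(1) by (simp add: field_simps)
        then have "\<forall>\<^sub>F w in at b within E. K < 20 * K * Re (H w)" by (rule order_tendstoD(1)[OF tH])
        moreover have "\<forall>\<^sub>F w in at b within E. w \<in> E" by (auto simp: eventually_at_filter)
        ultimately show ?thesis
        proof eventually_elim
          case (elim w)
          have "\<bar>u w\<bar> \<le> K" using elim(2) by (intro K(2)) (auto simp: E_def)
          moreover have "\<bar>\<sigma> * u w\<bar> = \<bar>u w\<bar>" using \<sigma> by (simp add: abs_mult)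
          ultimately show ?case using elim(1) \<eta> by linarith
        qed
      next
        case False
        then have "Im b \<in> {\<tau>0 (Re b), \<tau>1 (Re b)}" using b_S0 \<tau>_b by (auto simp: log_domain_def)
        then have "(u \<longlongrightarrow> 0) (at b within D)" by (rule trace[OF b_S0])
        then have "(u \<longlongrightarrow> 0) (at b within E)" by (rule tendsto_within_subset) (auto simp: E_def)
        then have l: "((\<lambda>w. \<sigma> * u w - 20 * K * Re (H w)) \<longlongrightarrow> \<sigma> * 0 - 20 * K * Re (H b)) (at b within E)"
          by (intro tendsto_intros tH)
        have "0 \<le> 20 * K * Re (H b)" using bb(1) K(1) by simp
        then show ?thesis using \<eta> by (intro order_tendstoD(2)[OF l]) linarith
      qed
    qed
    then show ?thesis by simp
  qed
  have tE: "Complex s t \<in> E" using t True by (simp add: E_def P_def)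
  have "\<bar>u (Complex s t)\<bar> \<le> 20 * K * Re (H (Complex s t))"
    using bound[of 1, OF _ tE] bound[of "-1", OF _ tE] by simp
  also have "Re (H (Complex s t)) = 4 * (t - \<tau>0 s) - (t - \<tau>0 s)\<^sup>2" by (simp add: Re_H P_def)
  also have "20 * K * \<dots> \<le> 20 * K * (4 * (t - \<tau>0 s))" using K(1) by (intro mult_left_mono) auto
  also have "\<dots> = 80 * K * (t - \<tau>0 s)" by simp
  finally show ?thesis .
qed

lemma lower_barrier:
  assumes flat: "\<And>s. N < s \<Longrightarrow> almost_flat \<tau>0 s" and N: "S0 \<le> N" and \<epsilon>: "0 < \<epsilon>"
    and small: "\<And>w. w \<in> D \<Longrightarrow> N < Re w \<Longrightarrow> \<bar>u w\<bar> \<le> \<epsilon> * exp (Re w)"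
    and w: "w \<in> D" "N + 1 < Re w"
  shows "\<bar>u w\<bar> \<le> 80 * (\<epsilon> * exp (Re w + 1)) * (Im w - \<tau>0 (Re w))"
proof -
  have "\<bar>u z\<bar> \<le> \<epsilon> * exp (Re w + 1)" if z: "z \<in> D" "\<bar>Re z - Re w\<bar> \<le> 1" for z
  proof -
    have "\<bar>u z\<bar> \<le> \<epsilon> * exp (Re z)" using z w by (intro small) auto
    also have "\<dots> \<le> \<epsilon> * exp (Re w + 1)" using z(2) \<epsilon> by (intro mult_left_mono) auto
    finally show ?thesis .
  qed
  then have "\<bar>u (Complex (Re w) (Im w))\<bar> \<le> 80 * (\<epsilon> * exp (Re w + 1)) * (Im w - \<tau>0 (Re w))"
    using w N \<epsilon> by (intro stream_barrier flat) auto
  then show ?thesis by simp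
qed

lemma upper_barrier:
  assumes flat: "\<And>s. N < s \<Longrightarrow> almost_flat \<tau>1 s" and N: "S0 \<le> N" and \<epsilon>: "0 < \<epsilon>"
    and small: "\<And>w. w \<in> D \<Longrightarrow> N < Re w \<Longrightarrow> \<bar>u w\<bar> \<le> \<epsilon> * exp (Re w)"
    and w: "w \<in> D" "N + 1 < Re w"
  shows "\<bar>u w\<bar> \<le> 80 * (\<epsilon> * exp (Re w + 1)) * (\<tau>1 (Re w) - Im w)"
proof -
  interpret c: log_flow S0 M "\<lambda>s. - \<tau>1 s" "\<lambda>s. - \<tau>0 s" "\<lambda>w. u (cnj w)" "\<lambda>w. cnj (g (cnj w))"
    by (rule log_flow_cnj[OF log_flow_axioms])
  have "\<bar>u (cnj (cnj w))\<bar> \<le> 80 * (\<epsilon> * exp (Re (cnj w) + 1)) * (Im (cnj w) - - \<tau>1 (Re (cnj w)))"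
  proof (rule c.lower_barrier[OF almost_flat_uminus[OF flat] N \<epsilon>])
    show "\<bar>u (cnj z)\<bar> \<le> \<epsilon> * exp (Re z)" if "z \<in> c.D" "N < Re z" for z
      using small[of "cnj z"] that by (simp add: cnj_log_domain)
  qed (use w in \<open>simp_all flip: cnj_log_domain\<close>)
  then show ?thesis by simp
qed

text \<open>With d the distance to the boundary curves measured vertically and capped at 1, the ball
  of radius d/4 stays in the domain, since the point and the curve each move by less than d/4, and
  distances to the nearer curve stay below 2d. So |u| is at most a small multiple of d on it, and d
  cancels in the gradient estimate. The constant is 1280 = 2 * (80 * 2) * 4, and
  \<open>exp 4\<close> collects \<open>exp 2\<close> from the gradient estimate and
  \<open>exp (Re w + 2)\<close>.\<close>

lemma gradient_small:
  assumes flat: "\<And>s. N < s \<Longrightarrow> almost_flat \<tau>0 s" "\<And>s. N < s \<Longrightarrow> almost_flat \<tau>1 s"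
    and N: "S0 \<le> N" and \<epsilon>: "0 < \<epsilon>"
    and small: "\<And>w. w \<in> D \<Longrightarrow> N < Re w \<Longrightarrow> \<bar>u w\<bar> \<le> \<epsilon> * exp (Re w)"
    and w: "w \<in> D" "N + 2 < Re w"
  shows "norm (g w) \<le> 1280 * exp 4 * \<epsilon> * exp (Re w)"
proof -
  define d where "d = min 1 (min (Im w - \<tau>0 (Re w)) (\<tau>1 (Re w) - Im w))"
  have d: "0 < d" "d \<le> 1" "d \<le> Im w - \<tau>0 (Re w)" "d \<le> \<tau>1 (Re w) - Im w"
    using w(1) by (auto simp: d_def log_domain_def)
  define K where "K = 80 * (\<epsilon> * exp (Re w + 2)) * (2 * d)"
  have K: "0 < K" using \<epsilon> d(1) by (simp add: K_def)
  have ball: "z \<in> D \<and> \<bar>u z\<bar> \<le> K" if z: "z \<in> ball w (d/4)" for z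
  proof -
    have nz: "norm (z - w) < d/4" using z by (simp add: dist_norm norm_minus_commute)
    have zr: "\<bar>Re z - Re w\<bar> < d/4" and zi: "\<bar>Im z - Im w\<bar> < d/4"
      using abs_Re_le_cmod[of "z - w"] abs_Im_le_cmod[of "z - w"] nz by simp_all
    have t0: "\<bar>\<tau>0 (Re z) - \<tau>0 (Re w)\<bar> \<le> \<bar>Re z - Re w\<bar>"
      using almost_flat_lipschitz[OF flat(1)[of "Re w"], of "Re z - Re w"] w zr d by simp
    have t1: "\<bar>\<tau>1 (Re z) - \<tau>1 (Re w)\<bar> \<le> \<bar>Re z - Re w\<bar>"
      using almost_flat_lipschitz[OF flat(2)[of "Re w"], of "Re z - Re w"] w zr d by simp
    have zN: "N + 1 < Re z" using zr d(2) w(2) by linarith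
    have zD: "z \<in> D"
      using zN N t0 t1 zr zi d unfolding log_domain_def by (simp only: mem_Collect_eq) linarith
    have zw: "Re z \<le> Re w + 1" using zr d(2) by linarith
    then have ex: "\<epsilon> * exp (Re z + 1) \<le> \<epsilon> * exp (Re w + 2)" using \<epsilon> by (intro mult_left_mono) auto
    have e0: "0 \<le> \<epsilon> * exp (Re z + 1)" using \<epsilon> by simp
    have "\<bar>u z\<bar> \<le> K"
    proof -
      \<comment> \<open>The barrier is used at whichever curve realises d; at the cap d = 1 the
        bound \<open>small\<close> suffices.\<close>
      consider "d = 1" | "d = Im w - \<tau>0 (Re w)" | "d = \<tau>1 (Re w) - Im w" unfolding d_def by linarith
      then show ?thesis
      proof cases
        case 1
        have "\<bar>u z\<bar> \<le> \<epsilon> * exp (Re z)" using small[OF zD] zN by simp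
        also have "\<dots> \<le> \<epsilon> * exp (Re w + 2)" using zw \<epsilon> by (intro mult_left_mono) auto
        also have "\<dots> \<le> K" using 1 \<epsilon> by (simp add: K_def)
        finally show ?thesis .
      next
        case 2
        have "\<bar>u z\<bar> \<le> 80 * (\<epsilon> * exp (Re z + 1)) * (Im z - \<tau>0 (Re z))"
          by (rule lower_barrier[OF flat(1) N \<epsilon> small zD zN])
        also have "\<dots> \<le> K" unfolding K_def
          by (rule mult_mono) (use ex e0 2 t0 zr zi d(1) in linarith)+
        finally show ?thesis .
      next
        case 3
        have "\<bar>u z\<bar> \<le> 80 * (\<epsilon> * exp (Re z + 1)) * (\<tau>1 (Re z) - Im z)"
          by (rule upper_barrier[OF flat(2) N \<epsilon> small zD zN])
        also have "\<dots> \<le> K" unfolding K_def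
          by (rule mult_mono) (use ex e0 3 t1 zr zi d(1) in linarith)+
        finally show ?thesis .
      qed
    qed
    with zD show ?thesis ..
  qed
  have "norm (g w) \<le> 2 * exp 2 * K / (d/4)"
    using d(1) K ball by (intro cgrad_on_gradient_bound[where v = u] cgrad_on_subset[OF cgrad]) auto
  also have "\<dots> = 1280 * (exp 2 * exp (Re w + 2)) * \<epsilon>" using d(1) by (simp add: K_def)
  also have "exp 2 * exp (Re w + 2) = exp 4 * exp (Re w)" by (simp flip: exp_add)
  finally show ?thesis by (simp add: mult_ac)
qed

end

section \<open>Logarithmic coordinates\<close>

text \<open>The mean value estimate is used twice, first for the slope and then for the curve minus
  its tangent line. This gives up the factor 1/2 of Taylor's formula, so the bound 1/10 on the
  second derivative reappears unchanged.\<close>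

lemma almost_flatI:
  assumes d1: "\<And>y. \<bar>y - s\<bar> \<le> 1 \<Longrightarrow> (\<tau> has_real_derivative \<tau>' y) (at y)"
    and d2: "\<And>y. \<bar>y - s\<bar> \<le> 1 \<Longrightarrow> (\<tau>' has_real_derivative \<tau>'' y) (at y)"
    and b1: "\<bar>\<tau>' s\<bar> \<le> 1/2" and b2: "\<And>y. \<bar>y - s\<bar> \<le> 1 \<Longrightarrow> \<bar>\<tau>'' y\<bar> \<le> 1/10"
  shows "almost_flat \<tau> s"
  unfolding almost_flat_def
proof (intro exI conjI allI impI)
  fix x :: real assume x: "\<bar>x\<bar> \<le> 1"
  let ?I = "{s - \<bar>x\<bar>..s + \<bar>x\<bar>}"
  have I: "\<bar>y - s\<bar> \<le> 1" if "y \<in> ?I" for y using that x by (auto simp: abs_le_iff)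
  have s: "s \<in> ?I" and sx: "s + x \<in> ?I" by auto
  have slope: "\<bar>\<tau>' y - \<tau>' s\<bar> \<le> \<bar>x\<bar> / 10" if y: "y \<in> ?I" for y
  proof -
    have "norm (\<tau>' y - \<tau>' s) \<le> 1/10 * norm (y - s)"
      by (rule field_differentiable_bound[of ?I \<tau>' \<tau>''])
         (use d2 b2 I y s in \<open>auto intro: has_field_derivative_at_within\<close>)
    then show ?thesis using y by (auto simp: abs_le_iff)
  qed
  have "norm ((\<tau> (s + x) - \<tau>' s * (s + x)) - (\<tau> s - \<tau>' s * s)) \<le> \<bar>x\<bar> / 10 * norm (s + x - s)"
  proof (rule field_differentiable_bound[of ?I "\<lambda>y. \<tau> y - \<tau>' s * y" "\<lambda>y. \<tau>' y - \<tau>' s"])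
    fix y assume y: "y \<in> ?I"
    have "((\<lambda>y. \<tau> y - \<tau>' s * y) has_real_derivative \<tau>' y - \<tau>' s) (at y)"
      using d1[OF I[OF y]] by (auto intro!: derivative_eq_intros)
    then show "((\<lambda>y. \<tau> y - \<tau>' s * y) has_field_derivative \<tau>' y - \<tau>' s) (at y within ?I)"
      by (rule has_field_derivative_at_within)
    show "norm (\<tau>' y - \<tau>' s) \<le> \<bar>x\<bar> / 10" using slope[OF y] by simp
  qed (use s sx in auto)
  moreover have "\<bar>x\<bar> / 10 * norm (s + x - s) = x\<^sup>2 / 10" by (simp add: power2_eq_square)
  moreover have "(\<tau> (s + x) - \<tau>' s * (s + x)) - (\<tau> s - \<tau>' s * s) = \<tau> (s + x) - \<tau> s - \<tau>' s * x"
    by (simp add: algebra_simps)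
  ultimately show "\<bar>\<tau> (s + x) - \<tau> s - \<tau>' s * x\<bar> \<le> x\<^sup>2 / 10" by simp
qed (rule b1)

text \<open>In s = log r the derivatives of the boundary angle are r \<theta>' and r^2 \<theta>'' +
  r \<theta>'. The powers of r cancel against the assumed decay and leave O(exp (-
  \<open>\<epsilon>\<close> s)), so flatness at unit scale holds far out.\<close>

lemma eventually_almost_flat_log:
  assumes r0: "0 < r0" and eps: "0 < \<epsilon>" and Ck: "Ck_on 3 \<theta> {r0<..}"
    and bd: "\<And>k r. k \<in> {1..3} \<Longrightarrow> r0 < r \<Longrightarrow> \<bar>(deriv ^^ k) \<theta> r\<bar> \<le> C * r powr (- real k - \<epsilon>)"
  shows "\<forall>\<^sub>F s in at_top. almost_flat (\<lambda>s. \<theta> (exp s)) s"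
proof -
  have diff: "((deriv ^^ i) \<theta> has_real_derivative (deriv ^^ Suc i) \<theta> r) (at r)" if "i < 3" "r0 < r" for i r
  proof -
    have "(deriv ^^ i) \<theta> field_differentiable (at r)"
      using Ck that unfolding Ck_on_def by blast
    then show ?thesis by (simp add: field_differentiable_derivI)
  qed
  define \<tau>' where "\<tau>' s = deriv \<theta> (exp s) * exp s" for s :: real
  define \<tau>'' where "\<tau>'' s = (deriv ^^ 2) \<theta> (exp s) * exp s * exp s + deriv \<theta> (exp s) * exp s" for s :: real
  have gt: "r0 < exp s" if "ln r0 < s" for s using that r0 by (metis exp_ln exp_less_cancel_iff)
  have d1: "((\<lambda>s. \<theta> (exp s)) has_real_derivative \<tau>' s) (at s)" if "ln r0 < s" for s
    using DERIV_chain2[OF diff[of 0 "exp s"] DERIV_exp] gt[OF that] by (simp add: \<tau>'_def)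
  have d2: "(\<tau>' has_real_derivative \<tau>'' s) (at s)" if "ln r0 < s" for s
  proof -
    have "((\<lambda>s. deriv \<theta> (exp s)) has_real_derivative (deriv ^^ 2) \<theta> (exp s) * exp s) (at s)"
      using DERIV_chain2[OF diff[of 1 "exp s"] DERIV_exp] gt[OF that] by (simp add: numeral_2_eq_2)
    from DERIV_mult[OF this DERIV_exp] show ?thesis
      unfolding \<tau>'_def \<tau>''_def by (simp add: mult.commute mult.left_commute)
  qed
  have b1: "\<bar>\<tau>' s\<bar> \<le> C * exp (- \<epsilon> * s)" if "ln r0 < s" for s
  proof -
    have "\<bar>deriv \<theta> (exp s)\<bar> * exp s \<le> C * exp s powr (- 1 - \<epsilon>) * exp s"
      using bd[of 1 "exp s"] gt[OF that] by (intro mult_right_mono) auto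
    also have "\<dots> = C * exp (- \<epsilon> * s)" by (simp add: exp_powr_real algebra_simps flip: exp_add)
    finally show ?thesis by (simp add: \<tau>'_def abs_mult)
  qed
  have b2: "\<bar>\<tau>'' s\<bar> \<le> 2 * C * exp (- \<epsilon> * s)" if "ln r0 < s" for s
  proof -
    have "\<bar>(deriv ^^ 2) \<theta> (exp s)\<bar> * (exp s * exp s) \<le> C * exp s powr (- 2 - \<epsilon>) * (exp s * exp s)"
      using bd[of 2 "exp s"] gt[OF that] by (intro mult_right_mono) auto
    also have "\<dots> = C * exp (- \<epsilon> * s)" by (simp add: exp_powr_real algebra_simps flip: exp_add)
    finally have "\<bar>(deriv ^^ 2) \<theta> (exp s) * exp s * exp s\<bar> \<le> C * exp (- \<epsilon> * s)"
      by (simp add: abs_mult mult.assoc)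
    then show ?thesis using b1[OF that] unfolding \<tau>''_def \<tau>'_def by linarith
  qed
  have "((\<lambda>s. 2 * C * exp (- \<epsilon> * s)) \<longlongrightarrow> 2 * C * 0) at_top"
    using eps by (intro tendsto_mult_left filterlim_compose[OF exp_at_bot]
      filterlim_tendsto_neg_mult_at_bot[OF tendsto_const] filterlim_ident) auto
  then have "\<forall>\<^sub>F s in at_top. 2 * C * exp (- \<epsilon> * s) < 1/10"
    by (rule order_tendstoD(2)) simp
  then obtain N where N: "\<And>s. N \<le> s \<Longrightarrow> 2 * C * exp (- \<epsilon> * s) < 1/10"
    unfolding eventually_at_top_linorder by blast
  show ?thesis
    using eventually_gt_at_top[of "max (ln r0) N + 1"]
  proof eventually_elim
    case (elim s)
    have near: "ln r0 < y" "N \<le> y" if "\<bar>y - s\<bar> \<le> 1" for y using that elim by linarith+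
    show ?case
    proof (rule almost_flatI[of _ _ \<tau>' \<tau>''])
      show "\<bar>\<tau>' s\<bar> \<le> 1/2" using b1[of s] N[of s] near[of s] abs_ge_zero[of "\<tau>' s"] by linarith
      show "\<bar>\<tau>'' y\<bar> \<le> 1/10" if "\<bar>y - s\<bar> \<le> 1" for y
        using b2[of y] N[of y] near[OF that] by linarith
    qed (use d1 d2 near in blast)+
  qed
qed

section \<open>Passage between the flow domain and its logarithm\<close>

lemma exp_log_domain:
  assumes "0 < r0"
  shows "flow_domain r0 \<theta>0 \<theta>1 = exp ` log_domain (ln r0) (\<lambda>s. \<theta>0 (exp s)) (\<lambda>s. \<theta>1 (exp s))"
proof (intro equalityI subsetI)
  fix z assume "z \<in> flow_domain r0 \<theta>0 \<theta>1"
  then obtain r t where z: "z = rcis r t" "r0 < r" "\<theta>0 r < t" "t < \<theta>1 r" by (auto simp: flow_domain_def)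
  have r: "0 < r" using z(2) assms by simp
  have "z = exp (Complex (ln r) t)" using r by (simp add: z(1) exp_eq_polar rcis_def)
  moreover have "Complex (ln r) t \<in> log_domain (ln r0) (\<lambda>s. \<theta>0 (exp s)) (\<lambda>s. \<theta>1 (exp s))"
    using z r assms by (simp add: log_domain_def)
  ultimately show "z \<in> exp ` log_domain (ln r0) (\<lambda>s. \<theta>0 (exp s)) (\<lambda>s. \<theta>1 (exp s))" by blast
next
  fix z assume "z \<in> exp ` log_domain (ln r0) (\<lambda>s. \<theta>0 (exp s)) (\<lambda>s. \<theta>1 (exp s))"
  then obtain w where w: "z = exp w" "ln r0 < Re w" "\<theta>0 (exp (Re w)) < Im w" "Im w < \<theta>1 (exp (Re w))"
    by (auto simp: log_domain_def)
  have "z = rcis (exp (Re w)) (Im w)" by (simp add: w(1) exp_eq_polar rcis_def)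
  moreover have "r0 < exp (Re w)" using w(2) assms by (metis exp_ln exp_less_cancel_iff)
  ultimately show "z \<in> flow_domain r0 \<theta>0 \<theta>1" using w unfolding flow_domain_def by blast
qed

text \<open>The exponential is a covering of the punctured plane, hence an open map; this yields
  openness of the flow domain.\<close>

lemma open_exp_image:
  assumes "open (S :: complex set)"
  shows "open (exp ` S)"
proof -
  have "openin (top_of_set (- {0})) (exp ` S)"
    by (rule covering_space_open_map[OF covering_space_exp_punctured_plane]) (use assms in simp)
  then show ?thesis by (meson openin_open_trans open_Compl closed_singleton)
qed

lemma cgrad_on_exp:
  assumes v: "cgrad_on v g S" and E: "\<And>w. w \<in> E \<Longrightarrow> exp w \<in> S"
  shows "cgrad_on (\<lambda>w. v (exp w)) (\<lambda>w. g (exp w) * exp w) E"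
proof -
  have "(g \<circ> exp) holomorphic_on E"
    by (rule holomorphic_on_compose_gen[where t = S])
       (use v E in \<open>auto simp: cgrad_on_def intro!: holomorphic_intros\<close>)
  then have "(\<lambda>w. g (exp w) * exp w) holomorphic_on E"
    by (intro holomorphic_intros) (simp add: o_def)
  moreover have "((\<lambda>w. v (exp w)) has_derivative (\<lambda>h. Re (g (exp w) * exp w * h))) (at w)"
    if "w \<in> E" for w
  proof -
    have "(v has_derivative (\<lambda>h. Re (g (exp w) * h))) (at (exp w))"
      using v E[OF that] unfolding cgrad_on_def by blast
    moreover have "(exp has_derivative (\<lambda>h. exp w * h)) (at w)"
      using DERIV_exp[of w] by (simp add: has_field_derivative_def)
    ultimately have "((\<lambda>w. v (exp w)) has_derivative (\<lambda>h. Re (g (exp w) * (exp w * h)))) (at w)"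
      by (rule has_derivative_compose[rotated])
    then show ?thesis by (simp add: mult.assoc)
  qed
  ultimately show ?thesis unfolding cgrad_on_def by blast
qed

text \<open>Carries the trace condition over to the logarithmic coordinate. Punctured neighbourhoods
  must go to punctured ones: within distance pi of \<open>b\<close> imaginary parts differ by less
  than 2 pi, so \<open>exp\<close> takes the value \<open>exp b\<close> only at
  \<open>b\<close>.\<close>

lemma filterlim_exp_at_within:
  fixes b :: complex
  shows "filterlim exp (at (exp b) within (exp ` D)) (at b within D)"
  unfolding filterlim_at
proof
  show "(exp \<longlongrightarrow> exp b) (at b within D)" by (intro tendsto_intros)
  have "exp w \<noteq> exp b" if w: "w \<noteq> b" "dist w b < pi" for w
  proof
    assume "exp w = exp b"
    moreover have "\<bar>Im w - Im b\<bar> < 2 * pi"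
      using abs_Im_le_cmod[of "w - b"] w(2) pi_gt_zero by (simp add: dist_norm)
    ultimately show False using w(1) exp_complex_eqI by blast
  qed
  then show "\<forall>\<^sub>F w in at b within D. exp w \<in> exp ` D \<and> exp w \<noteq> exp b"
    unfolding eventually_at by (intro exI[of _ pi]) auto
qed

theorem theorem2:
  fixes r0 :: real and \<theta>0 \<theta>1 :: "real \<Rightarrow> real" and \<psi> :: "complex \<Rightarrow> real"
  assumes "near_infinity_data r0 \<theta>0 \<theta>1"
    and "domain_angle \<theta>0 \<theta>1 \<notin> {0, pi, 2 * pi}"
    and "incompressible_flow r0 \<theta>0 \<theta>1 \<psi>"
    and "bounded (velocity \<psi> ` flow_domain r0 \<theta>0 \<theta>1)"
  shows "((\<lambda>R. SUP z\<in>{z \<in> flow_domain r0 \<theta>0 \<theta>1. norm z > R}. norm (velocity \<psi> z))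
            \<longlongrightarrow> 0) at_top"
proof -
  obtain C \<epsilon> where r0: "0 < r0" and eps: "0 < \<epsilon>"
    and bd: "\<And>\<theta> k r. \<theta> \<in> {\<theta>0, \<theta>1} \<Longrightarrow> k \<in> {1..3} \<Longrightarrow> r0 < r \<Longrightarrow>
               \<bar>(deriv ^^ k) \<theta> r\<bar> \<le> C * r powr (- real k - \<epsilon>)"
    and Ck: "Ck_on 3 \<theta>0 {r0<..}" "Ck_on 3 \<theta>1 {r0<..}"
    and gap: "\<And>r. r0 < r \<Longrightarrow> 0 < \<theta>1 r - \<theta>0 r \<and> \<theta>1 r - \<theta>0 r < 2 * pi"
    using assms(1) unfolding near_infinity_data_def by blast
  let ?\<Omega> = "flow_domain r0 \<theta>0 \<theta>1"
  define \<tau>0 \<tau>1 where "\<tau>0 s = \<theta>0 (exp s)" and "\<tau>1 s = \<theta>1 (exp s)" for s :: real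
  let ?D = "log_domain (ln r0) \<tau>0 \<tau>1"
  have gt: "r0 < exp s" if "ln r0 < s" for s using that r0 by (metis exp_ln exp_less_cancel_iff)
  have \<Omega>: "?\<Omega> = exp ` ?D" using exp_log_domain[OF r0] by (simp add: \<tau>0_def[abs_def] \<tau>1_def[abs_def])
  have "continuous_on {ln r0<..} (\<lambda>s. \<theta> (exp s))" if "Ck_on 3 \<theta> {r0<..}" for \<theta>
  proof -
    have "\<theta> field_differentiable (at r)" if "r0 < r" for r
      using \<open>Ck_on 3 \<theta> {r0<..}\<close> that unfolding Ck_on_def
      by (metis (no_types, lifting) funpow_0 greaterThan_iff zero_less_numeral)
    then have "continuous_on {r0<..} \<theta>"
      by (intro continuous_at_imp_continuous_on) (auto intro: field_differentiable_imp_continuous_at)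
    then show ?thesis
      by (rule continuous_on_compose2) (auto intro!: continuous_intros gt)
  qed
  then have cont: "continuous_on {ln r0<..} \<tau>0" "continuous_on {ln r0<..} \<tau>1"
    using Ck unfolding \<tau>0_def \<tau>1_def by blast+
  have opn: "open ?\<Omega>" unfolding \<Omega> by (intro open_exp_image open_log_domain cont)
  have harm: "cgrad_on \<psi> (stream_gradient \<psi>) ?\<Omega>"
    using assms(3) harmonic_on_cgrad_on[OF opn] by (simp add: incompressible_flow_def)
  obtain M where M: "\<And>z. z \<in> ?\<Omega> \<Longrightarrow> norm (velocity \<psi> z) \<le> M"
    using assms(4) by (auto simp: bounded_iff)
  define u g where "u w = \<psi> (exp w)" and "g w = stream_gradient \<psi> (exp w) * exp w" for w
  have norm_g: "norm (g w) = norm (velocity \<psi> (exp w)) * exp (Re w)" for w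
    by (simp add: g_def norm_mult norm_velocity)
  define A B where "A = Lim at_top \<theta>0" and "B = Lim at_top \<theta>1"
  have limA: "(\<theta>0 \<longlongrightarrow> A) at_top" and limB: "(\<theta>1 \<longlongrightarrow> B) at_top"
    using near_infinity_data_limits[OF assms(1)] by (auto simp: A_def B_def)
  have angle: "0 \<le> B - A" "B - A \<le> 2 * pi"
  proof -
    have l: "((\<lambda>r. \<theta>1 r - \<theta>0 r) \<longlongrightarrow> B - A) at_top" by (intro tendsto_intros limA limB)
    show "0 \<le> B - A"
      by (rule tendsto_lowerbound[OF l _ trivial_limit_at_top_linorder], rule eventually_mono[OF eventually_gt_at_top[of r0]])
         (use gap in \<open>auto intro: less_imp_le\<close>)
    show "B - A \<le> 2 * pi"
      by (rule tendsto_upperbound[OF l _ trivial_limit_at_top_linorder], rule eventually_mono[OF eventually_gt_at_top[of r0]])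
         (use gap in \<open>auto intro: less_imp_le\<close>)
  qed
  have angle_ne: "B - A \<noteq> 0" "B - A \<noteq> pi" "B - A \<noteq> 2 * pi"
    using assms(2) by (auto simp: domain_angle_def A_def B_def)
  \<comment> \<open>The limiting angle lies in the closed interval from 0 to 2 pi, whose only
    multiples of pi are the three excluded values.\<close>
  have nonint: "B - A \<noteq> real n * pi" for n :: nat
  proof
    assume eq: "B - A = real n * pi"
    then have "real n * pi \<le> 2 * pi" using angle(2) by simp
    then have "n \<le> 2" using pi_gt_zero by simp
    then have "n = 0 \<or> n = 1 \<or> n = 2" by linarith
    then show False using eq angle_ne by auto
  qed
  interpret near_strip_flow "ln r0" M \<tau>0 \<tau>1 u g A B
  proof
    show "cgrad_on u g ?D"
      unfolding u_def g_def by (rule cgrad_on_exp[OF harm]) (simp add: \<Omega>)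
    show "norm (g w) \<le> M * exp (Re w)" if "w \<in> ?D" for w
      unfolding norm_g using that by (intro mult_right_mono M) (auto simp: \<Omega>)
    show "(u \<longlongrightarrow> 0) (at b within ?D)" if "ln r0 < Re b" "Im b \<in> {\<tau>0 (Re b), \<tau>1 (Re b)}" for b
    proof -
      have "exp b = rcis (exp (Re b)) (Im b)" by (simp add: exp_eq_polar rcis_def)
      then have "exp b \<in> solid_boundary r0 \<theta>0 \<theta>1"
        using that gt[OF that(1)] unfolding solid_boundary_def \<tau>0_def \<tau>1_def by blast
      then have "(\<psi> \<longlongrightarrow> 0) (at (exp b) within exp ` ?D)"
        using assms(3) by (simp add: incompressible_flow_def \<Omega>)
      then show ?thesis unfolding u_def by (rule filterlim_compose[OF _ filterlim_exp_at_within])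
    qed
    show "(\<tau>0 \<longlongrightarrow> A) at_top" "(\<tau>1 \<longlongrightarrow> B) at_top"
      unfolding \<tau>0_def \<tau>1_def
      using filterlim_compose[OF limA exp_at_top] filterlim_compose[OF limB exp_at_top] by auto
    show "A < B" using angle(1) angle_ne(1) by simp
  qed (use cont nonint in auto)
  have "\<forall>\<^sub>F s in at_top. almost_flat \<tau>0 s \<and> almost_flat \<tau>1 s"
    unfolding \<tau>0_def[abs_def] \<tau>1_def[abs_def]
    by (intro eventually_conj eventually_almost_flat_log[OF r0 eps, where C = C] Ck bd) simp_all
  then obtain N1 where N1: "\<And>s. N1 \<le> s \<Longrightarrow> almost_flat \<tau>0 s \<and> almost_flat \<tau>1 s"
    unfolding eventually_at_top_linorder by blast
  have far: "\<exists>R0. \<forall>z\<in>?\<Omega>. R0 < norm z \<longrightarrow> norm (velocity \<psi> z) \<le> \<eta>" if \<eta>: "0 < \<eta>" for \<eta>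
  proof -
    \<comment> \<open>Chosen to absorb the constant of \<open>gradient_small\<close>; the factor
      \<open>exp (Re w)\<close> is removed by \<open>norm_g\<close>.\<close>
    define e where "e = \<eta> / (1280 * exp 4)"
    have e: "0 < e" "1280 * exp 4 * e = \<eta>" using \<eta> by (simp_all add: e_def)
    obtain N2 where N2: "\<And>w. w \<in> D \<Longrightarrow> N2 < Re w \<Longrightarrow> \<bar>u w\<bar> \<le> e * exp (Re w)"
      using stream_sublinear[OF e(1)] by blast
    define N where "N = max (max N1 N2) (ln r0)"
    have "norm (velocity \<psi> z) \<le> \<eta>" if z: "z \<in> ?\<Omega>" "exp (N + 2) < norm z" for z
    proof -
      obtain w where w: "w \<in> D" "z = exp w" using z(1) unfolding \<Omega> by blast
      have "N + 2 < Re w" using z(2) by (simp add: w(2))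
      then have "norm (g w) \<le> 1280 * exp 4 * e * exp (Re w)"
        using w(1) e(1) N1 N2 by (intro gradient_small[of N]) (auto simp: N_def)
      then show ?thesis unfolding norm_g e(2) w(2) by simp
    qed
    then show ?thesis by blast
  qed
  \<comment> \<open>A real supremum is meaningful only for nonempty sets that are bounded above, so
    the region beyond each radius is shown to be nonempty.\<close>
  have ne: "{z \<in> ?\<Omega>. R < norm z} \<noteq> {}" for R
  proof -
    define r where "r = max R r0 + 1"
    have r: "r0 < r" "R < r" "0 < r" using r0 by (auto simp: r_def)
    have "rcis r ((\<theta>0 r + \<theta>1 r) / 2) \<in> ?\<Omega>"
      using r(1) gap[OF r(1)] unfolding flow_domain_def
      by (intro CollectI exI[of _ r] exI[of _ "(\<theta>0 r + \<theta>1 r) / 2"]) (auto simp: field_simps)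
    moreover have "R < norm (rcis r ((\<theta>0 r + \<theta>1 r) / 2))" using r by simp
    ultimately show ?thesis by blast
  qed
  have nonneg: "0 \<le> (SUP z\<in>{z \<in> ?\<Omega>. R < norm z}. norm (velocity \<psi> z))" for R
  proof -
    obtain z where z: "z \<in> {z \<in> ?\<Omega>. R < norm z}" using ne by blast
    have "bdd_above ((\<lambda>z. norm (velocity \<psi> z)) ` {z \<in> ?\<Omega>. R < norm z})"
      using M by (intro bdd_aboveI[of _ M]) auto
    from cSUP_upper[OF z this] show ?thesis using norm_ge_zero order_trans by blast
  qed
  show ?thesis
  proof (rule tendstoI)
    fix e :: real assume e: "0 < e"
    obtain R0 where R0: "\<And>z. z \<in> ?\<Omega> \<Longrightarrow> R0 < norm z \<Longrightarrow> norm (velocity \<psi> z) \<le> e/2"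
      using far[of "e/2"] e by auto
    show "\<forall>\<^sub>F R in at_top. dist (SUP z\<in>{z \<in> ?\<Omega>. R < norm z}. norm (velocity \<psi> z)) 0 < e"
      using eventually_ge_at_top[of R0]
    proof eventually_elim
      case (elim R)
      have "(SUP z\<in>{z \<in> ?\<Omega>. R < norm z}. norm (velocity \<psi> z)) \<le> e/2"
        using elim R0 by (intro cSUP_least ne) auto
      then show ?case using nonneg[of R] e by (simp add: dist_real_def)
    qed
  qed
qed

end
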